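(* Let $F_0$ be a field of characteristic $2$, let $F=F_0((c^{-1}))((b^{-1}))((a^{-1}))$ be the field of iterated Laurent series in the indeterminates $c^{-1},b^{-1},a^{-1}$, and let $Q=[a,c)$ over $F$. The biquaternion algebra with symplectic involution \[(C,\gamma)=\bigl([a+b,c),\bar{\ \,}\bigr)\otimes_F\bigl([a,b),\bar{\ \,}\bigr)\] satisfies the following: it is anisotropic, it becomes hyperbolic over $F_Q$, and it does not contain any $\gamma$-stable subalgebra isomorphic (as an algebra with involution) to $(Q,\bar{\ \,})$.
   Context: For a field $F$ of characteristic $2$, $\alpha\in F$, $\beta\in F^\times$, $[\alpha,\beta)$ is the quaternion $F$-algebra generated by $i,j$ with $i^2-i=\alpha$, $j^2=\beta$, $jij^{-1}=i-1$; $\bar{\ \,}$ denotes the canonical (symplectic) involution of a quaternion algebra. For a quaternion division algebra $Q=[\alpha,\beta)$, $F_Q$ denotes the function field of its Severi-Brauer variety, which is the projective conic $x^2+xy+\alpha y^2+\beta z^2=0$. Let $(A,\sigma)$ be a central simple $F$-algebra with symplectic involution. A right ideal $I\subset A$ is isotropic if $\sigma(x)y=0$ for all $x,y\in I$; such an ideal has dimension at most $\frac12\dim_F(A)$. $(A,\sigma)$ is isotropic if it contains a non-zero isotropic right ideal, anisotropic otherwise, and hyperbolic if it contains an isotropic right ideal of dimension $\frac12\dim_F(A)$. *)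

theory Defs
  imports
    "HOL-Analysis.Analysis"
    "HOL-Computational_Algebra.Computational_Algebra"
begin

section \<open>Finite-dimensional algebras with involution in coordinates\<close>

text \<open>
  An algebra with (linear) involution over a field \<open>'k\<close>, with underlying vector space
  \<open>'k ^ 'n\<close>. It is given by its structure constants: the products and the conjugates of the
  standard basis vectors, extended (bi)linearly by \<open>alg_mult\<close> and \<open>alg_inv\<close> below.
\<close>

record ('k, 'n) inv_alg =
  basis_mult :: "'n \<Rightarrow> 'n \<Rightarrow> 'k ^ 'n"
  alg_one :: "'k ^ 'n"
  basis_inv :: "'n \<Rightarrow> 'k ^ 'n"

definition alg_mult :: "('k::field, 'n::finite) inv_alg \<Rightarrow> 'k ^ 'n \<Rightarrow> 'k ^ 'n \<Rightarrow> 'k ^ 'n" where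
  "alg_mult A x y = (\<Sum>s\<in>UNIV. \<Sum>t\<in>UNIV. (vec_nth x s * vec_nth y t) *s basis_mult A s t)"

definition alg_inv :: "('k::field, 'n::finite) inv_alg \<Rightarrow> 'k ^ 'n \<Rightarrow> 'k ^ 'n" where
  "alg_inv A x = (\<Sum>s\<in>UNIV. vec_nth x s *s basis_inv A s)"

definition pure_tensor :: "'k::field ^ 'm::finite \<Rightarrow> 'k ^ 'n::finite \<Rightarrow> 'k ^ ('m \<times> 'n)" where
  "pure_tensor x y = (\<chi> p. vec_nth x (fst p) * vec_nth y (snd p))"

text \<open>
  The basis vector with index \<open>(s, t)\<close> of the tensor product is the tensor of the basis
  vectors with indices \<open>s\<close> and \<open>t\<close>.
\<close>

definition tensor_alg ::
  "('k::field, 'm::finite) inv_alg \<Rightarrow> ('k, 'n::finite) inv_alg \<Rightarrow> ('k, 'm \<times> 'n) inv_alg" where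
  "tensor_alg A B =
    \<lparr> basis_mult = (\<lambda>p q. pure_tensor (basis_mult A (fst p) (fst q)) (basis_mult B (snd p) (snd q))),
      alg_one = pure_tensor (alg_one A) (alg_one B),
      basis_inv = (\<lambda>p. pure_tensor (basis_inv A (fst p)) (basis_inv B (snd p))) \<rparr>"

definition map_vec :: "('k \<Rightarrow> 'l) \<Rightarrow> 'k ^ 'n \<Rightarrow> 'l ^ 'n" where
  "map_vec \<phi> x = (\<chi> i. \<phi> (vec_nth x i))"

text \<open>
  Scalar extension along a field homomorphism \<open>\<phi>\<close>: the structure constants are mapped by \<open>\<phi>\<close>.
\<close>

definition extend_scalars ::
  "('k::field \<Rightarrow> 'l::field) \<Rightarrow> ('k, 'n::finite) inv_alg \<Rightarrow> ('l, 'n) inv_alg" where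
  "extend_scalars \<phi> A =
    \<lparr> basis_mult = (\<lambda>s t. map_vec \<phi> (basis_mult A s t)),
      alg_one = map_vec \<phi> (alg_one A),
      basis_inv = (\<lambda>s. map_vec \<phi> (basis_inv A s)) \<rparr>"

definition right_ideal :: "('k::field, 'n::finite) inv_alg \<Rightarrow> ('k ^ 'n) set \<Rightarrow> bool" where
  "right_ideal A I \<longleftrightarrow> vec.subspace I \<and> (\<forall>x\<in>I. \<forall>y. alg_mult A x y \<in> I)"

definition isotropic_right_ideal :: "('k::field, 'n::finite) inv_alg \<Rightarrow> ('k ^ 'n) set \<Rightarrow> bool" where
  "isotropic_right_ideal A I \<longleftrightarrow>
    right_ideal A I \<and> (\<forall>x\<in>I. \<forall>y\<in>I. alg_mult A (alg_inv A x) y = 0)"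

definition isotropic :: "('k::field, 'n::finite) inv_alg \<Rightarrow> bool" where
  "isotropic A \<longleftrightarrow> (\<exists>I. isotropic_right_ideal A I \<and> I \<noteq> {0})"

definition anisotropic :: "('k::field, 'n::finite) inv_alg \<Rightarrow> bool" where
  "anisotropic A \<longleftrightarrow> \<not> isotropic A"

definition hyperbolic :: "('k::field, 'n::finite) inv_alg \<Rightarrow> bool" where
  "hyperbolic A \<longleftrightarrow>
    (\<exists>I. isotropic_right_ideal A I \<and> 2 * vec.dim I = vec.dim (UNIV :: ('k ^ 'n) set))"

definition subalgebra :: "('k::field, 'n::finite) inv_alg \<Rightarrow> ('k ^ 'n) set \<Rightarrow> bool" where
  "subalgebra A S \<longleftrightarrow>
    vec.subspace S \<and> alg_one A \<in> S \<and> (\<forall>x\<in>S. \<forall>y\<in>S. alg_mult A x y \<in> S)"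

definition stable_subalgebra :: "('k::field, 'n::finite) inv_alg \<Rightarrow> ('k ^ 'n) set \<Rightarrow> bool" where
  "stable_subalgebra A S \<longleftrightarrow> subalgebra A S \<and> (\<forall>x\<in>S. alg_inv A x \<in> S)"

text \<open>The algebra with involution \<open>B\<close> is isomorphic to the stable subalgebra \<open>S\<close> of \<open>A\<close>.\<close>

definition isomorphic_to_subalgebra ::
  "('k::field, 'm::finite) inv_alg \<Rightarrow> ('k, 'n::finite) inv_alg \<Rightarrow> ('k ^ 'n) set \<Rightarrow> bool" where
  "isomorphic_to_subalgebra B A S \<longleftrightarrow>
    (\<exists>f. Vector_Spaces.linear (*s) (*s) f \<and> bij_betw f UNIV S \<and>
      f (alg_one B) = alg_one A \<and>
      (\<forall>x y. f (alg_mult B x y) = alg_mult A (f x) (f y)) \<and>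
      (\<forall>x. f (alg_inv B x) = alg_inv A (f x)))"

lemma pure_tensor_sum_left: "pure_tensor (sum f I) y = (\<Sum>i\<in>I. pure_tensor (f i) y)"
  by (simp add: pure_tensor_def vec_eq_iff sum_component sum_distrib_right)

lemma pure_tensor_sum_right: "pure_tensor x (sum f I) = (\<Sum>i\<in>I. pure_tensor x (f i))"
  by (simp add: pure_tensor_def vec_eq_iff sum_component sum_distrib_left)

lemma pure_tensor_scale:
  "pure_tensor (c *s x) y = c *s pure_tensor x y" "pure_tensor x (c *s y) = c *s pure_tensor x y"
  by (simp_all add: pure_tensor_def vec_eq_iff ac_simps)

lemma alg_mult_pure_tensor:
  "alg_mult (tensor_alg A B) (pure_tensor x y) (pure_tensor x' y') =
    pure_tensor (alg_mult A x x') (alg_mult B y y')"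
proof -
  have "pure_tensor (alg_mult A x x') (alg_mult B y y') =
    (\<Sum>s\<in>UNIV. \<Sum>t\<in>UNIV. \<Sum>s'\<in>UNIV. \<Sum>t'\<in>UNIV.
      (vec_nth x s * vec_nth x' t * (vec_nth y s' * vec_nth y' t')) *s
      pure_tensor (basis_mult A s t) (basis_mult B s' t'))"
    unfolding alg_mult_def pure_tensor_sum_left pure_tensor_scale
    unfolding pure_tensor_sum_right pure_tensor_scale
    by (simp add: vec.scale_sum_right vector_smult_assoc)
  also have "\<dots> = (\<Sum>s\<in>UNIV. \<Sum>s'\<in>UNIV. \<Sum>t\<in>UNIV. \<Sum>t'\<in>UNIV.
      (vec_nth x s * vec_nth x' t * (vec_nth y s' * vec_nth y' t')) *s
      pure_tensor (basis_mult A s t) (basis_mult B s' t'))"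
    by (rule sum.cong[OF refl], rule sum.swap)
  also have "\<dots> = alg_mult (tensor_alg A B) (pure_tensor x y) (pure_tensor x' y')"
    unfolding alg_mult_def UNIV_Times_UNIV[symmetric] sum.cartesian_product'
    by (simp add: tensor_alg_def pure_tensor_def ac_simps)
  finally show ?thesis ..
qed

lemma alg_inv_pure_tensor:
  "alg_inv (tensor_alg A B) (pure_tensor x y) = pure_tensor (alg_inv A x) (alg_inv B y)"
proof -
  have "pure_tensor (alg_inv A x) (alg_inv B y) =
    (\<Sum>s\<in>UNIV. \<Sum>t\<in>UNIV.
      (vec_nth x s * vec_nth y t) *s pure_tensor (basis_inv A s) (basis_inv B t))"
    unfolding alg_inv_def pure_tensor_sum_left pure_tensor_scale
    unfolding pure_tensor_sum_right pure_tensor_scale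
    by (simp add: vec.scale_sum_right vector_smult_assoc)
  also have "\<dots> = alg_inv (tensor_alg A B) (pure_tensor x y)"
    unfolding alg_inv_def UNIV_Times_UNIV[symmetric] sum.cartesian_product'
    by (simp add: tensor_alg_def pure_tensor_def ac_simps)
  finally show ?thesis ..
qed


section \<open>Quaternion algebras in characteristic 2\<close>

datatype quat_basis = Q1 | Qi | Qj | Qij

lemma UNIV_quat_basis: "(UNIV :: quat_basis set) = {Q1, Qi, Qj, Qij}"
  using quat_basis.exhaust by blast

instance quat_basis :: finite
  by standard (simp add: UNIV_quat_basis)

text \<open>
  \<open>quat \<alpha> \<beta>\<close> is \<open>[\<alpha>, \<beta>)\<close>, with basis \<open>1\<close>, \<open>i\<close>, \<open>j\<close>, \<open>ij\<close> and the canonical involution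
  \<open>x \<mapsto> Trd x - x\<close>. The table follows from \<open>i\<^sup>2 - i = \<alpha>\<close>, \<open>j\<^sup>2 = \<beta>\<close> and
  \<open>j i = (i - 1) j\<close>. It is meant for characteristic 2 and \<open>\<beta> \<noteq> 0\<close> only; otherwise these
  relations are not those of a quaternion algebra.
\<close>

fun quat_basis_mult :: "'k::field \<Rightarrow> 'k \<Rightarrow> quat_basis \<Rightarrow> quat_basis \<Rightarrow> 'k ^ quat_basis" where
  "quat_basis_mult \<alpha> \<beta> Q1 t = axis t 1"
| "quat_basis_mult \<alpha> \<beta> s Q1 = axis s 1"
| "quat_basis_mult \<alpha> \<beta> Qi Qi = axis Qi 1 + axis Q1 \<alpha>"
| "quat_basis_mult \<alpha> \<beta> Qi Qj = axis Qij 1"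
| "quat_basis_mult \<alpha> \<beta> Qi Qij = axis Qij 1 + axis Qj \<alpha>"
| "quat_basis_mult \<alpha> \<beta> Qj Qi = axis Qij 1 - axis Qj 1"
| "quat_basis_mult \<alpha> \<beta> Qj Qj = axis Q1 \<beta>"
| "quat_basis_mult \<alpha> \<beta> Qj Qij = axis Qi \<beta> - axis Q1 \<beta>"
| "quat_basis_mult \<alpha> \<beta> Qij Qi = axis Qj \<alpha>"
| "quat_basis_mult \<alpha> \<beta> Qij Qj = axis Qi \<beta>"
| "quat_basis_mult \<alpha> \<beta> Qij Qij = axis Q1 (\<alpha> * \<beta>)"

fun quat_basis_inv :: "quat_basis \<Rightarrow> 'k::field ^ quat_basis" where
  "quat_basis_inv Q1 = axis Q1 1"
| "quat_basis_inv Qi = axis Q1 1 - axis Qi 1"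
| "quat_basis_inv Qj = - axis Qj 1"
| "quat_basis_inv Qij = - axis Qij 1"

definition quat :: "'k::field \<Rightarrow> 'k \<Rightarrow> ('k, quat_basis) inv_alg" where
  "quat \<alpha> \<beta> =
    \<lparr> basis_mult = quat_basis_mult \<alpha> \<beta>, alg_one = axis Q1 1, basis_inv = quat_basis_inv \<rparr>"

lemma quat_mult_nth:
  fixes \<alpha> \<beta> :: "'k::field" and x y :: "'k ^ quat_basis"
  assumes "CHAR('k) = 2"
  shows
    "vec_nth (alg_mult (quat \<alpha> \<beta>) x y) Q1 = vec_nth x Q1 * vec_nth y Q1 + \<alpha> * vec_nth x Qi * vec_nth y Qi
       + \<beta> * (vec_nth x Qj * vec_nth y Qj + vec_nth x Qj * vec_nth y Qij + \<alpha> * vec_nth x Qij * vec_nth y Qij)" (is ?A)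
    "vec_nth (alg_mult (quat \<alpha> \<beta>) x y) Qi = vec_nth x Q1 * vec_nth y Qi + vec_nth x Qi * vec_nth y Q1
       + vec_nth x Qi * vec_nth y Qi + \<beta> * (vec_nth x Qj * vec_nth y Qij + vec_nth x Qij * vec_nth y Qj)" (is ?B)
    "vec_nth (alg_mult (quat \<alpha> \<beta>) x y) Qj = vec_nth x Q1 * vec_nth y Qj + vec_nth x Qj * vec_nth y Q1
       + vec_nth x Qj * vec_nth y Qi + \<alpha> * (vec_nth x Qi * vec_nth y Qij + vec_nth x Qij * vec_nth y Qi)" (is ?C)
    "vec_nth (alg_mult (quat \<alpha> \<beta>) x y) Qij = vec_nth x Q1 * vec_nth y Qij + vec_nth x Qij * vec_nth y Q1
       + vec_nth x Qi * vec_nth y Qj + vec_nth x Qj * vec_nth y Qi + vec_nth x Qi * vec_nth y Qij" (is ?D)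
proof -
  have minus: "- z = z" "w - z = w + z" for z w :: 'k
    using assms by (simp_all add: uminus_CHAR_2 minus_CHAR_2)
  show ?A ?B ?C ?D
    by (simp_all add: alg_mult_def quat_def UNIV_quat_basis axis_def minus)
      (simp_all add: algebra_simps)
qed

lemma quat_inv_nth:
  fixes x :: "'k::field ^ quat_basis"
  assumes "CHAR('k) = 2"
  shows
    "vec_nth (alg_inv (quat \<alpha> \<beta>) x) Q1 = vec_nth x Q1 + vec_nth x Qi"
    "vec_nth (alg_inv (quat \<alpha> \<beta>) x) Qi = vec_nth x Qi"
    "vec_nth (alg_inv (quat \<alpha> \<beta>) x) Qj = vec_nth x Qj"
    "vec_nth (alg_inv (quat \<alpha> \<beta>) x) Qij = vec_nth x Qij"
  using assms
  by (simp_all add: alg_inv_def quat_def UNIV_quat_basis axis_def uminus_CHAR_2 minus_CHAR_2)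

lemma quat_eq_iff:
  "x = y \<longleftrightarrow> vec_nth x Q1 = vec_nth y Q1 \<and> vec_nth x Qi = vec_nth y Qi \<and>
    vec_nth x Qj = vec_nth y Qj \<and> vec_nth x Qij = vec_nth y Qij"
  unfolding vec_eq_iff by (auto, rename_tac s, case_tac s) auto

lemma quat_presentation:
  fixes \<alpha> \<beta> :: "'k::field"
  defines "i \<equiv> axis Qi 1" and "j \<equiv> axis Qj 1" and "e \<equiv> alg_one (quat \<alpha> \<beta>)"
    and "m \<equiv> alg_mult (quat \<alpha> \<beta>)"
  assumes "CHAR('k) = 2"
  shows "m i i - i = \<alpha> *s e" "m j j = \<beta> *s e" "m j i = m (i - e) j" "m i j = axis Qij 1"
    "m e x = x" "m x e = x" "m (m x y) z = m x (m y z)"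
proof -
  have two: "u + u = 0" "u + (u + v) = v" for u v :: 'k
    using minus_CHAR_2[OF assms(5), of u u] by (simp_all add: add.assoc[symmetric])
  note nth = quat_mult_nth[OF assms(5)]
  have e: "alg_one (quat \<alpha> \<beta>) = axis Q1 1"
    by (simp add: quat_def)
  show "m i i - i = \<alpha> *s e" "m j j = \<beta> *s e" "m j i = m (i - e) j" "m i j = axis Qij 1"
    "m e x = x" "m x e = x"
    unfolding assms(1-4)
    by (simp_all add: quat_eq_iff nth e axis_def two
        minus_CHAR_2[OF assms(5)] uminus_CHAR_2[OF assms(5)])
  show "m (m x y) z = m x (m y z)"
    unfolding assms(1-4) by (simp add: quat_eq_iff nth algebra_simps two)
qed

lemma quat_involution:
  fixes \<alpha> \<beta> :: "'k::field" and x y :: "'k ^ quat_basis"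
  defines "m \<equiv> alg_mult (quat \<alpha> \<beta>)" and "bar \<equiv> alg_inv (quat \<alpha> \<beta>)"
    and "e \<equiv> alg_one (quat \<alpha> \<beta>)"
  assumes "CHAR('k) = 2"
  shows "bar (m x y) = m (bar y) (bar x)" "bar (bar x) = x"
    "\<exists>t. x + bar x = t *s e" "\<exists>n. m x (bar x) = n *s e"
proof -
  have two: "u + u = 0" "u + (u + v) = v" for u v :: 'k
    using minus_CHAR_2[OF assms(4), of u u] by (simp_all add: add.assoc[symmetric])
  note nth = quat_mult_nth[OF assms(4)] quat_inv_nth[OF assms(4)]
  have e: "e = axis Q1 1"
    by (simp add: e_def quat_def)
  show "bar (m x y) = m (bar y) (bar x)" "bar (bar x) = x"
    unfolding m_def bar_def by (simp_all add: quat_eq_iff nth algebra_simps two)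
  show "\<exists>t. x + bar x = t *s e"
    unfolding e bar_def by (rule exI[of _ "vec_nth x Qi"]) (simp add: quat_eq_iff nth axis_def algebra_simps two)
  show "\<exists>n. m x (bar x) = n *s e"
    unfolding e m_def bar_def
    by (rule exI[of _ "vec_nth (m x (bar x)) Q1"])
      (simp add: m_def bar_def quat_eq_iff nth axis_def algebra_simps two)
qed


section \<open>The field of iterated Laurent series\<close>

text \<open>
  \<open>F = F\<^sub>0((c\<^sup>-\<^sup>1))((b\<^sup>-\<^sup>1))((a\<^sup>-\<^sup>1))\<close>: the innermost variable of the iterated
  Laurent series is \<open>c\<^sup>-\<^sup>1\<close>, the outermost one is \<open>a\<^sup>-\<^sup>1\<close>; \<open>fls_X_inv\<close> is the inverse of the variable.
\<close>

type_synonym 'f laurent3 = "'f fls fls fls"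

definition gen_a :: "'f::field laurent3" where "gen_a = fls_X_inv"
definition gen_b :: "'f::field laurent3" where "gen_b = fls_const fls_X_inv"
definition gen_c :: "'f::field laurent3" where "gen_c = fls_const (fls_const fls_X_inv)"


section \<open>The function field of the conic of \<open>[a, c)\<close>\<close>

text \<open>
  \<open>x\<^sup>2 + x y + \<alpha> y\<^sup>2 + \<beta>\<close>, the equation of the affine chart \<open>z = 1\<close> of the conic,
  as a polynomial in \<open>x\<close> (outer variable) over the polynomials in \<open>y\<close> (inner variable).
\<close>

definition conic_poly :: "'k::field \<Rightarrow> 'k \<Rightarrow> 'k poly poly" where
  "conic_poly \<alpha> \<beta> = [: [:\<beta>, 0, \<alpha>:], [:0, 1:], 1 :]"

definition conic_rel :: "'f::field laurent3 poly poly \<Rightarrow> 'f laurent3 poly poly \<Rightarrow> bool" where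
  "conic_rel p q \<longleftrightarrow> conic_poly gen_a gen_c dvd p - q"

lemma equivp_conic_rel: "equivp (conic_rel :: 'f::field laurent3 poly poly \<Rightarrow> _)"
proof (rule equivpI)
  show "reflp (conic_rel :: 'f laurent3 poly poly \<Rightarrow> _)"
    by (simp add: reflp_def conic_rel_def)
  show "symp (conic_rel :: 'f laurent3 poly poly \<Rightarrow> _)"
    unfolding symp_def conic_rel_def by (metis dvd_minus_iff minus_diff_eq)
  show "transp (conic_rel :: 'f laurent3 poly poly \<Rightarrow> _)"
    unfolding transp_def conic_rel_def
  proof (intro allI impI)
    fix p q r :: "'f laurent3 poly poly"
    assume "conic_poly gen_a gen_c dvd p - q" "conic_poly gen_a gen_c dvd q - r"
    then have "conic_poly gen_a gen_c dvd (p - q) + (q - r)"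
      by (rule dvd_add)
    then show "conic_poly gen_a gen_c dvd p - r"
      by simp
  qed
qed

lemma conic_rel_eqI: "p = q \<Longrightarrow> conic_rel p q"
  by (simp add: conic_rel_def)

text \<open>
  The coordinate ring \<open>F[x, y] / (x\<^sup>2 + x y + a y\<^sup>2 + c)\<close> of this affine chart. It is shown
  below to be an integral domain; its field of fractions \<open>'f conic_field\<close> is the function field
  \<open>F\<^sub>Q\<close> of the conic, for \<open>Q = [a, c)\<close>.
\<close>

quotient_type (overloaded) 'f conic_ring = "'f::field laurent3 poly poly" / conic_rel
  by (rule equivp_conic_rel)

instantiation conic_ring :: (field) comm_ring_1
begin

lift_definition zero_conic_ring :: "'a conic_ring" is 0 .
lift_definition one_conic_ring :: "'a conic_ring" is 1 .

lift_definition plus_conic_ring :: "'a conic_ring \<Rightarrow> 'a conic_ring \<Rightarrow> 'a conic_ring" is "(+)"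
proof -
  fix p q r s :: "'a laurent3 poly poly"
  assume "conic_rel p q" "conic_rel r s"
  then have "conic_poly gen_a gen_c dvd (p - q) + (r - s)"
    unfolding conic_rel_def by (rule dvd_add)
  then show "conic_rel (p + r) (q + s)"
    by (simp add: conic_rel_def algebra_simps)
qed

lift_definition uminus_conic_ring :: "'a conic_ring \<Rightarrow> 'a conic_ring" is uminus
  unfolding conic_rel_def by (metis dvd_minus_iff minus_diff_minus)

lift_definition minus_conic_ring :: "'a conic_ring \<Rightarrow> 'a conic_ring \<Rightarrow> 'a conic_ring" is "(-)"
proof -
  fix p q r s :: "'a laurent3 poly poly"
  assume "conic_rel p q" "conic_rel r s"
  then have "conic_poly gen_a gen_c dvd (p - q) - (r - s)"
    unfolding conic_rel_def by (rule dvd_diff)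
  then show "conic_rel (p - r) (q - s)"
    by (simp add: conic_rel_def algebra_simps)
qed

lift_definition times_conic_ring :: "'a conic_ring \<Rightarrow> 'a conic_ring \<Rightarrow> 'a conic_ring" is "(*)"
proof -
  fix p q r s :: "'a laurent3 poly poly"
  assume "conic_rel p q" "conic_rel r s"
  then have "conic_poly gen_a gen_c dvd (p - q) * r + q * (r - s)"
    unfolding conic_rel_def by (intro dvd_add dvd_mult2 dvd_mult)
  then show "conic_rel (p * r) (q * s)"
    by (simp add: conic_rel_def algebra_simps)
qed

lemma conic_poly_not_dvd_1: "\<not> conic_poly \<alpha> \<beta> dvd 1"
proof
  assume "conic_poly \<alpha> \<beta> dvd 1"
  then have "degree (conic_poly \<alpha> \<beta>) \<le> degree (1 :: 'b poly poly)"
    by (rule dvd_imp_degree_le) simp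
  then show False
    by (simp add: conic_poly_def)
qed

instance
proof
  show "(0 :: 'a conic_ring) \<noteq> 1"
    by transfer (simp add: conic_rel_def conic_poly_not_dvd_1)
qed (transfer, rule conic_rel_eqI, simp add: algebra_simps)+

end

lemma conic_poly_remainder:
  obtains q r0 r1 where "p = conic_poly \<alpha> \<beta> * q + [:r0, r1:]"
proof -
  let ?g = "conic_poly \<alpha> \<beta>"
  have g: "?g \<noteq> 0" "lead_coeff ?g = 1" "degree ?g = 2"
    by (simp_all add: conic_poly_def)
  obtain q r where qr: "pseudo_divmod p ?g = (q, r)"
    by fastforce
  have "p = ?g * q + r" and r: "r = 0 \<or> degree r < 2"
    using pseudo_divmod[OF g(1) qr] g(2) unfolding g(3) by simp_all
  moreover have "r = [:coeff r 0, coeff r 1:]"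
  proof (rule poly_eqI)
    fix n
    show "coeff r n = coeff [:coeff r 0, coeff r 1:] n"
    proof (cases "n < 2")
      case True
      then have "n = 0 \<or> n = 1" by auto
      then show ?thesis by auto
    next
      case False
      then have "coeff r n = 0"
        using r by (auto intro: coeff_eq_0)
      moreover from False obtain m where "n = Suc (Suc m)"
        using that[of "n - 2"] by simp
      ultimately show ?thesis by simp
    qed
  qed
  ultimately show thesis
    using that by metis
qed

lemma conic_poly_dvd_linear:
  assumes "conic_poly \<alpha> \<beta> dvd [:r0, r1:]"
  shows "r0 = 0" "r1 = 0"
proof -
  have "[:r0, r1:] = 0"
  proof (rule ccontr)
    assume "[:r0, r1:] \<noteq> 0"
    with assms have "degree (conic_poly \<alpha> \<beta>) \<le> degree [:r0, r1:]"
      by (rule dvd_imp_degree_le)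
    moreover have "degree [:r0, r1:] \<le> 1"
      by (simp add: degree_pCons_eq_if)
    ultimately show False
      by (simp add: conic_poly_def)
  qed
  then show "r0 = 0" "r1 = 0"
    by (simp_all del: pCons_eq_0_iff add: pCons_eq_0_iff)
qed

lemma gen_a_norm_nonzero:
  fixes u v :: "'f::field laurent3"
  assumes "u\<^sup>2 - u * v + gen_a * v\<^sup>2 = 0"
  shows "u = 0 \<and> v = 0"
proof (cases "v = 0")
  case True
  then show ?thesis using assms by simp
next
  case False
  define w where "w = u / v"
  have "w * (1 - w) = (u * v - u\<^sup>2) / v\<^sup>2"
    using False by (simp add: w_def field_simps power2_eq_square)
  also have "u * v - u\<^sup>2 = gen_a * v\<^sup>2"
    using assms by algebra
  finally have eq: "w * (1 - w) = fls_X_inv"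
    using False by (simp add: gen_a_def)
  then have "w * (1 - w) \<noteq> 0"
    by simp
  then have nz: "w \<noteq> 0" "1 - w \<noteq> 0"
    unfolding mult_eq_0_iff by blast+
  have sum: "fls_subdegree w + fls_subdegree (1 - w) = -1"
    using fls_subdegree_mult[OF nz] unfolding eq by simp
  show ?thesis
  proof (cases "fls_subdegree w < 0")
    case True
    have "fls_subdegree (1 - w) = fls_subdegree w"
      using fls_subdegree_diff_eq2[of w 1] True nz by simp
    then show ?thesis
      using sum by presburger
  next
    case False
    then have "fls_subdegree (1 - w) \<ge> 0"
      using fls_subdegree_minus[of 1 w] nz by simp
    then show ?thesis
      using sum False by simp
  qed
qed

lemma coeff_mult_top:
  fixes p q :: "'k::idom poly"
  assumes "degree p \<le> m" "degree q \<le> n"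
  shows "coeff (p * q) (m + n) = coeff p m * coeff q n"
proof (cases "degree p = m \<and> degree q = n")
  case True
  then show ?thesis by (auto simp: coeff_mult_degree_sum)
next
  case False
  then have "degree p < m \<or> degree q < n"
    using assms by auto
  then have "coeff p m * coeff q n = 0"
    by (auto simp: coeff_eq_0)
  moreover have "degree (p * q) < m + n"
    using degree_mult_le[of p q] assms \<open>degree p < m \<or> degree q < n\<close> by linarith
  ultimately show ?thesis by (simp add: coeff_eq_0)
qed

lemma conic_norm_nonzero:
  fixes p q :: "'f::field laurent3 poly"
  assumes eq: "p\<^sup>2 - [:0, 1:] * p * q + [:gen_c, 0, gen_a:] * q\<^sup>2 = 0"
  shows "p = 0 \<and> q = 0"
proof (cases "q = 0")
  case True
  then show ?thesis using eq by simp
next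
  case False
  define m where "m = max (degree p) (degree q + 1)"
  define n where "n = m - 1"
  have m: "m = n + 1" and p: "degree p \<le> m" and q: "degree q \<le> n"
    by (auto simp: m_def n_def)
  have a: "degree [:gen_c, 0, gen_a :: 'f laurent3:] \<le> 2"
    by (simp add: degree_pCons_eq_if)
  have "coeff (p\<^sup>2) (m + m) = (coeff p m)\<^sup>2"
    using coeff_mult_top[OF p p] by (simp add: power2_eq_square)
  moreover have "coeff ([:0, 1:] * p * q) (m + m) = coeff p m * coeff q n"
    using coeff_mult_top[OF p q] by (simp add: m mult.assoc)
  moreover have "coeff ([:gen_c, 0, gen_a:] * q\<^sup>2) (m + m) = gen_a * (coeff q n)\<^sup>2"
  proof -
    have "degree (q\<^sup>2) \<le> n + n"
      using degree_mult_le[of q q] q by (simp add: power2_eq_square)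
    from coeff_mult_top[OF a this] have
      "coeff ([:gen_c, 0, gen_a:] * q\<^sup>2) (2 + (n + n)) = gen_a * coeff (q\<^sup>2) (n + n)"
      by (simp add: numeral_2_eq_2)
    also have "2 + (n + n) = m + m"
      by (simp add: m)
    also have "coeff (q\<^sup>2) (n + n) = (coeff q n)\<^sup>2"
      using coeff_mult_top[OF q q] by (simp add: power2_eq_square)
    finally show ?thesis .
  qed
  ultimately have "(coeff p m)\<^sup>2 - coeff p m * coeff q n + gen_a * (coeff q n)\<^sup>2 = 0"
    using arg_cong[OF eq, of "\<lambda>r. coeff r (m + m)"] by (simp del: mult_pCons_left)
  then have "coeff p m = 0" "coeff q n = 0"
    using gen_a_norm_nonzero by blast+
  moreover have "degree p = m \<and> p \<noteq> 0 \<or> degree q = n"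
    by (auto simp: m_def n_def max_def)
  ultimately show ?thesis
    using False by auto
qed

lemma conic_poly_prime:
  fixes p q :: "'f::field laurent3 poly poly"
  assumes "conic_poly gen_a gen_c dvd p * q"
  shows "conic_poly gen_a gen_c dvd p \<or> conic_poly gen_a gen_c dvd q"
proof -
  let ?g = "conic_poly gen_a gen_c :: 'f laurent3 poly poly"
  let ?N = "[:gen_c, 0, gen_a :: 'f laurent3:]" and ?Y = "[:0, 1 :: 'f laurent3:]"
  obtain k p0 p1 where p: "p = ?g * k + [:p0, p1:]"
    by (rule conic_poly_remainder)
  obtain l q0 q1 where q: "q = ?g * l + [:q0, q1:]"
    by (rule conic_poly_remainder)
  define r0 r1 where "r0 = p0 * q0 - ?N * (p1 * q1)"
    and "r1 = p0 * q1 + p1 * q0 - ?Y * (p1 * q1)"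
  have "[:p0, p1:] * [:q0, q1:] = ?g * [:p1 * q1:] + [:r0, r1:]"
    by (simp add: conic_poly_def r0_def r1_def algebra_simps)
  then have "p * q = ?g * (k * q + [:p0, p1:] * l + [:p1 * q1:]) + [:r0, r1:]"
    by (simp only: p q ring_distribs ac_simps)
  with assms have "?g dvd [:r0, r1:]"
    by (metis dvd_add_right_iff dvd_triv_left)
  then have r: "r0 = 0" "r1 = 0"
    by (rule conic_poly_dvd_linear)+
  define nm where "nm = p0\<^sup>2 - ?Y * p0 * p1 + ?N * p1\<^sup>2"
  have "nm * q0 = (p0 - ?Y * p1) * r0 + ?N * p1 * r1" "nm * q1 = p0 * r1 - p1 * r0"
    unfolding nm_def r0_def r1_def by algebra+
  then have "nm = 0 \<or> q0 = 0 \<and> q1 = 0"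
    using r by auto
  moreover have "p0 = 0 \<and> p1 = 0" if "nm = 0"
    using conic_norm_nonzero[of p0 p1] that by (simp add: nm_def)
  ultimately show ?thesis
    using p q by auto
qed

instance conic_ring :: (field) idom
  by standard (transfer, use conic_poly_prime in \<open>auto simp: conic_rel_def\<close>)

type_synonym 'f conic_field = "'f conic_ring fract"

text \<open>The embedding of \<open>F\<close> into the function field, as constants.\<close>

definition conic_embed :: "'f::field laurent3 \<Rightarrow> 'f conic_field" where
  "conic_embed u = Fract (abs_conic_ring [:[:u:]:]) 1"

lemma conic_embed_hom:
  fixes u v :: "'f::field laurent3"
  shows
  "conic_embed 1 = (1 :: 'f conic_field)"
  "conic_embed (u + v) = conic_embed u + conic_embed v"
  "conic_embed (u * v) = conic_embed u * conic_embed v"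
proof -
  have "abs_conic_ring [:[:1:]:] = (1 :: 'f conic_ring)"
    by (simp add: one_conic_ring.abs_eq one_pCons)
  then show "conic_embed 1 = (1 :: 'f conic_field)"
    by (simp add: conic_embed_def One_fract_def)
  show "conic_embed (u + v) = conic_embed u + conic_embed v"
    by (simp add: conic_embed_def plus_conic_ring.abs_eq)
  show "conic_embed (u * v) = conic_embed u * conic_embed v"
    by (simp add: conic_embed_def times_conic_ring.abs_eq)
qed

end

theory Submission
  imports Defs
begin

text \<open>
  Write \<open>i, j\<close> and \<open>k, l\<close> for the generators of the two factors of \<open>C\<close>. The element
  \<open>e = i + k + l\<close> is a symmetric idempotent with \<open>e l e = 0\<close>, and every \<open>y \<in> C e\<close> has the form
  \<open>(p + l q) e\<close> with \<open>p, q \<in> [a + b, c)\<close> and \<open>\<gamma>(y) y = (N p + b N q) e\<close>. The form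
  \<open>N \<bottom> b N\<close> is anisotropic over the iterated Laurent series by a Springer type argument, which
  gives anisotropy of \<open>\<gamma>\<close>. Over the function field of the conic it has an explicit zero, because
  \<open>c = x\<^sup>2 + x y + (a + b) y\<^sup>2 + b y\<^sup>2\<close>; this zero generates an isotropic right ideal of half the
  dimension.

  An embedding of \<open>[a, c)\<close> would make the
  8-dimensional space \<open>C e\<close> a module over \<open>[b, c) \<otimes> [a + b, b)\<close>, which is impossible since that
  algebra is a division algebra of dimension 16. Concretely, such a module yields
  \<open>h\<^sub>0, h\<^sub>1 \<in> [b, c)\<close>, not both zero, with \<open>h\<^sub>0\<^sup>2 + h\<^sub>1 h\<^sub>0 + (a + b) h\<^sub>1\<^sup>2 \<in> {0, b}\<close>, and
  comparing leading coefficients in \<open>a\<close> a square root of \<open>0\<close> or \<open>b\<close> in the division algebra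
  \<open>[b, c)\<close> over \<open>F\<^sub>0((c\<^sup>-\<^sup>1))((b\<^sup>-\<^sup>1))\<close>.
\<close>

section \<open>Leading coefficients of Laurent series\<close>

text \<open>A lower bound is used instead of \<open>fls_subdegree\<close> so that \<open>0\<close>
  satisfies every bound and all coordinates of a vector can share one.\<close>

definition fls_order_ge :: "int \<Rightarrow> 'k::zero fls \<Rightarrow> bool" where
  "fls_order_ge n f \<longleftrightarrow> (\<forall>m<n. fls_nth f m = 0)"

lemma fls_order_geD: "fls_order_ge n f \<Longrightarrow> m < n \<Longrightarrow> fls_nth f m = 0"
  by (simp add: fls_order_ge_def)

lemma fls_order_ge_iff: "fls_order_ge n f \<longleftrightarrow> f = 0 \<or> n \<le> fls_subdegree f"
  unfolding fls_order_ge_def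
  by (metis fls_eq0_below_subdegree fls_subdegree_geI fls_zero_nth order_less_le_trans)

lemma fls_order_ge_0 [simp]: "fls_order_ge n 0"
  by (simp add: fls_order_ge_def)

lemma fls_order_ge_mono: "fls_order_ge n f \<Longrightarrow> m \<le> n \<Longrightarrow> fls_order_ge m f"
  by (simp add: fls_order_ge_def)

lemma fls_order_ge_mult:
  fixes f g :: "'k::field fls"
  assumes "fls_order_ge m f" "fls_order_ge n g"
  shows "fls_order_ge (m + n) (f * g)"
  using assms unfolding fls_order_ge_iff by (cases "f = 0 \<or> g = 0") auto

text \<open>The bounds need not be sharp: if one of them lies strictly below the order of its
  series, both sides are \<open>0\<close>.\<close>

lemma fls_nth_mult_order:
  fixes f g :: "'k::field fls"
  assumes "fls_order_ge m f" "fls_order_ge n g"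
  shows "fls_nth (f * g) (m + n) = fls_nth f m * fls_nth g n"
proof (cases "f = 0 \<or> g = 0")
  case True
  then show ?thesis by auto
next
  case False
  then have le: "m \<le> fls_subdegree f" "n \<le> fls_subdegree g"
    using assms by (auto simp: fls_order_ge_iff)
  show ?thesis
  proof (cases "m = fls_subdegree f \<and> n = fls_subdegree g")
    case True
    then show ?thesis by simp
  next
    case False
    then have lt: "m < fls_subdegree f \<or> n < fls_subdegree g"
      using le by auto
    then have "m + n < fls_subdegree f + fls_subdegree g"
      using le by linarith
    then have "fls_nth (f * g) (m + n) = 0"
      by (rule fls_times_nth_eq0)
    moreover have "fls_nth f m * fls_nth g n = 0"
      using lt by auto
    ultimately show ?thesis by simp
  qed
qed

lemma fls_leading_family:
  fixes x :: "'n::finite \<Rightarrow> 'k::field fls"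
  assumes "x i \<noteq> 0"
  obtains n i where "\<And>i. fls_order_ge n (x i)" "fls_nth (x i) n \<noteq> 0"
proof -
  let ?S = "(\<lambda>i. fls_subdegree (x i)) ` {i. x i \<noteq> 0}"
  have S: "finite ?S" "?S \<noteq> {}"
    using assms by auto
  obtain j where j: "x j \<noteq> 0" "fls_subdegree (x j) = Min ?S"
    using Min_in[OF S] by auto
  have "fls_order_ge (Min ?S) (x i)" for i
    using Min_le[OF S(1), of "fls_subdegree (x i)"] unfolding fls_order_ge_iff by blast
  moreover have "fls_nth (x j) (Min ?S) \<noteq> 0"
    using j by (metis nth_fls_subdegree_nonzero)
  ultimately show thesis
    by (rule that)
qed

section \<open>Quadratic forms over Laurent series\<close>

definition diagonal_anisotropic :: "('n::finite \<Rightarrow> 'k::field) \<Rightarrow> bool" where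
  "diagonal_anisotropic d \<longleftrightarrow> (\<forall>x. (\<Sum>i\<in>UNIV. d i * (x i)\<^sup>2) = 0 \<longrightarrow> (\<forall>i. x i = 0))"

lemma diagonal_anisotropicD:
  "diagonal_anisotropic d \<Longrightarrow> (\<Sum>i\<in>UNIV. d i * (x i)\<^sup>2) = 0 \<Longrightarrow> x i = 0"
  unfolding diagonal_anisotropic_def by blast

text \<open>
  The terms with \<open>x\<close> alone have even and those with \<open>T y\<^sup>2\<close> odd degree in \<open>T = X\<^sup>-\<^sup>1\<close>,
  and no other term can reach the larger of the two degrees; so the leading coefficient
  is a value of the diagonal form.
\<close>

lemma springer_anisotropic:
  fixes d \<epsilon> :: "'n::finite \<Rightarrow> 'k::field" and x y :: "'n \<Rightarrow> 'k fls"
  assumes d: "diagonal_anisotropic d"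
    and eq: "(\<Sum>i\<in>UNIV. fls_const (d i) *
      ((x i)\<^sup>2 + fls_const (\<epsilon> i) * (x i * y i) + (fls_X_inv + fls_const \<beta>) * (y i)\<^sup>2)) = 0"
  shows "x i = 0 \<and> y i = 0"
proof (rule ccontr)
  assume neg: "\<not> (x i = 0 \<and> y i = 0)"
  have coeff: "(\<Sum>i\<in>UNIV. d i * (fls_nth ((x i)\<^sup>2) m + \<epsilon> i * fls_nth (x i * y i) m +
      (fls_nth ((y i)\<^sup>2) (m + 1) + \<beta> * fls_nth ((y i)\<^sup>2) m))) = 0" for m
    using arg_cong[OF eq, of "\<lambda>f. fls_nth f m"]
    by (simp add: fls_nth_sum distrib_right fls_X_inv_times_conv_shift)
  have fam: "\<exists>n. (\<forall>i. fls_order_ge n (z i)) \<and> ((\<exists>i. fls_nth (z i) n \<noteq> 0))"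
    if "z i \<noteq> 0" for z :: "'n \<Rightarrow> 'k fls" and i
    using fls_leading_family[of z i] that by metis
  have x_dom: False
    if n: "\<And>i. fls_order_ge n (x i)" "fls_nth (x j) n \<noteq> 0" and m: "\<And>i. fls_order_ge (n + 1) (y i)"
    for n j
  proof -
    have "fls_nth ((x i)\<^sup>2) (n + n) = (fls_nth (x i) n)\<^sup>2" for i
      using fls_nth_mult_order[OF n(1) n(1)] by (simp add: power2_eq_square)
    moreover have "fls_nth (x i * y i) (n + n) = 0" for i
      by (rule fls_order_geD[OF fls_order_ge_mult[OF n(1) m]]) simp
    moreover have "fls_nth ((y i)\<^sup>2) (n + n + 1) = 0" "fls_nth ((y i)\<^sup>2) (n + n) = 0" for i
      unfolding power2_eq_square by (rule fls_order_geD[OF fls_order_ge_mult[OF m m]], simp)+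
    ultimately have "(\<Sum>i\<in>UNIV. d i * (fls_nth (x i) n)\<^sup>2) = 0"
      using coeff[of "n + n"] by simp
    from diagonal_anisotropicD[OF d this] show False
      using n(2) by blast
  qed
  \<comment> \<open>\<open>fls_X_inv\<close> lowers indices by one, so its term starts at
    \<open>n + n - 1\<close>, while the squares and products without it start no earlier than
    \<open>n + n\<close>. Equal bounds therefore suffice here, whereas \<open>x_dom\<close> needs
    \<open>n + 1\<close> for \<open>y\<close>; together the two cover all cases.\<close>
  have y_dom: False
    if n: "\<And>i. fls_order_ge n (y i)" "fls_nth (y j) n \<noteq> 0" and m: "\<And>i. fls_order_ge n (x i)"
    for n j
  proof -
    have "fls_nth ((y i)\<^sup>2) (n + n) = (fls_nth (y i) n)\<^sup>2" for i
      using fls_nth_mult_order[OF n(1) n(1)] by (simp add: power2_eq_square)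
    moreover have "fls_nth (x i * y i) (n + n - 1) = 0" for i
      by (rule fls_order_geD[OF fls_order_ge_mult[OF m n(1)]]) simp
    moreover have "fls_nth ((x i)\<^sup>2) (n + n - 1) = 0" "fls_nth ((y i)\<^sup>2) (n + n - 1) = 0" for i
      unfolding power2_eq_square
      by (rule fls_order_geD[OF fls_order_ge_mult[OF m m]], simp)
        (rule fls_order_geD[OF fls_order_ge_mult[OF n(1) n(1)]], simp)
    ultimately have "(\<Sum>i\<in>UNIV. d i * (fls_nth (y i) n)\<^sup>2) = 0"
      using coeff[of "n + n - 1"] by simp
    from diagonal_anisotropicD[OF d this] show False
      using n(2) by blast
  qed
  consider "\<forall>i. y i = 0" | "\<forall>i. x i = 0" | j k where "x j \<noteq> 0" "y k \<noteq> 0"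
    by blast
  then show False
  proof cases
    case 1
    then obtain n j where "\<forall>i. fls_order_ge n (x i)" "fls_nth (x j) n \<noteq> 0"
      using fam[of x i] neg by auto
    then show False using x_dom[of n j] 1 by auto
  next
    case 2
    then obtain n j where "\<forall>i. fls_order_ge n (y i)" "fls_nth (y j) n \<noteq> 0"
      using fam[of y i] neg by auto
    then show False using y_dom[of n j] 2 by auto
  next
    case 3
    obtain n j where n: "\<forall>i. fls_order_ge n (x i)" "fls_nth (x j) n \<noteq> 0"
      using fam 3(1) by metis
    obtain m k where m: "\<forall>i. fls_order_ge m (y i)" "fls_nth (y k) m \<noteq> 0"
      using fam 3(2) by metis
    show False
    proof (cases "n < m")
      case True
      then show False
        using x_dom[of n j] n m(1) fls_order_ge_mono[of m _ "n + 1"] by auto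
    next
      case False
      then show False
        using y_dom[of m k] m n(1) fls_order_ge_mono[of n _ m] by auto
    qed
  qed
qed

text \<open>This is \<open>springer_anisotropic\<close> with \<open>\<epsilon>\<close> and
  \<open>\<beta>\<close> equal to \<open>0\<close>. The sum type indexes the orthogonal sum of
  \<open>d\<close> and its multiple by the inverse variable, so iteration adds one variable at a
  time.\<close>

lemma diagonal_anisotropic_laurent:
  fixes d :: "'n::finite \<Rightarrow> 'k::field"
  assumes "diagonal_anisotropic d"
  shows "diagonal_anisotropic
    (case_sum (\<lambda>i. fls_const (d i)) (\<lambda>i. fls_const (d i) * fls_X_inv))"
  unfolding diagonal_anisotropic_def
proof (intro allI impI)
  fix z :: "'n + 'n \<Rightarrow> 'k fls" and s
  assume "(\<Sum>i\<in>UNIV. case_sum (\<lambda>i. fls_const (d i)) (\<lambda>i. fls_const (d i) * fls_X_inv) i * (z i)\<^sup>2) = 0"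
  then have "(\<Sum>i\<in>UNIV. fls_const (d i) * ((z (Inl i))\<^sup>2 + fls_const 0 * (z (Inl i) * z (Inr i)) +
      (fls_X_inv + fls_const 0) * (z (Inr i))\<^sup>2)) = 0"
    by (simp add: UNIV_Plus_UNIV[symmetric] sum.Plus sum.distrib distrib_left mult.assoc
        del: UNIV_Plus_UNIV)
  from springer_anisotropic[OF assms this] show "z s = 0"
    by (cases s) auto
qed

lemma diagonal_anisotropic_one: "diagonal_anisotropic (\<lambda>_::unit. 1 :: 'k::field)"
  by (simp add: diagonal_anisotropic_def UNIV_unit)


section \<open>Algebras without zero divisors over Laurent series\<close>

definition no_zero_divisors :: "('k::field, 'n::finite) inv_alg \<Rightarrow> bool" where
  "no_zero_divisors A \<longleftrightarrow> (\<forall>x y. alg_mult A x y = 0 \<longrightarrow> x = 0 \<or> y = 0)"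

lemma no_zero_divisorsD: "no_zero_divisors A \<Longrightarrow> alg_mult A x y = 0 \<Longrightarrow> x = 0 \<or> y = 0"
  by (simp add: no_zero_divisors_def)

lemma alg_mult_nth:
  "vec_nth (alg_mult A x y) i =
    (\<Sum>s\<in>UNIV. \<Sum>t\<in>UNIV. vec_nth x s * vec_nth y t * vec_nth (basis_mult A s t) i)"
  by (simp add: alg_mult_def)

definition vec_order_ge :: "int \<Rightarrow> 'k::zero fls ^ 'n \<Rightarrow> bool" where
  "vec_order_ge n x \<longleftrightarrow> (\<forall>i. fls_order_ge n (vec_nth x i))"

definition vec_coeff :: "'k::zero fls ^ 'n \<Rightarrow> int \<Rightarrow> 'k ^ 'n" where
  "vec_coeff x n = (\<chi> i. fls_nth (vec_nth x i) n)"

lemma vec_coeff_add: "vec_coeff (x + y) n = vec_coeff x n + vec_coeff y n"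
  by (simp add: vec_coeff_def vec_eq_iff)

lemma vec_coeff_X_inv:
  fixes x :: "'k::field fls ^ 'n"
  shows "vec_coeff (fls_X_inv *s x) n = vec_coeff x (n + 1)"
  by (simp add: vec_coeff_def vec_eq_iff fls_X_inv_times_conv_shift)

lemma vec_coeff_const:
  fixes x :: "'k::field fls ^ 'n"
  shows "vec_coeff (fls_const u *s x) n = u *s vec_coeff x n"
  by (simp add: vec_coeff_def vec_eq_iff)

lemma vec_coeff_map_const: "vec_coeff (map_vec fls_const x) n = (if n = 0 then x else 0)"
  by (simp add: vec_coeff_def vec_eq_iff map_vec_def)

lemma vec_coeff_below: "vec_order_ge n x \<Longrightarrow> m < n \<Longrightarrow> vec_coeff x m = 0"
  by (auto simp: vec_coeff_def vec_order_ge_def vec_eq_iff intro: fls_order_geD)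

lemma vec_order_ge_0 [simp]: "vec_order_ge n 0"
  by (simp add: vec_order_ge_def)

lemma vec_order_ge_mono: "vec_order_ge n x \<Longrightarrow> m \<le> n \<Longrightarrow> vec_order_ge m x"
  unfolding vec_order_ge_def using fls_order_ge_mono by blast

lemma vec_leading:
  fixes x :: "'k::field fls ^ 'n::finite"
  assumes "x \<noteq> 0"
  obtains n where "vec_order_ge n x" "vec_coeff x n \<noteq> 0"
proof -
  obtain i where "vec_nth x i \<noteq> 0"
    using assms by (auto simp: vec_eq_iff)
  from fls_leading_family[where x = "vec_nth x", OF this] that show thesis
    unfolding vec_order_ge_def vec_coeff_def vec_eq_iff by (metis vec_lambda_beta zero_index)
qed

text \<open>The structure constants of the extended algebra are constant series: they do not shift
  indices, and only the coefficients at \<open>m\<close> and \<open>n\<close> meet at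
  \<open>m + n\<close>.\<close>

lemma vec_mult_order:
  fixes A :: "('k::field, 'n::finite) inv_alg" and x y :: "'k fls ^ 'n"
  assumes "vec_order_ge m x" "vec_order_ge n y"
  shows "vec_order_ge (m + n) (alg_mult (extend_scalars fls_const A) x y)"
    and "vec_coeff (alg_mult (extend_scalars fls_const A) x y) (m + n) =
      alg_mult A (vec_coeff x m) (vec_coeff y n)"
proof -
  have xy: "fls_order_ge (m + n) (vec_nth x s * vec_nth y t)" for s t
    using assms fls_order_ge_mult unfolding vec_order_ge_def by blast
  have nth: "fls_nth (vec_nth x s * vec_nth y t) (m + n) =
      fls_nth (vec_nth x s) m * fls_nth (vec_nth y t) n" for s t
    using assms fls_nth_mult_order unfolding vec_order_ge_def by blast
  have "fls_nth (vec_nth (alg_mult (extend_scalars fls_const A) x y) i) k =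
      (\<Sum>s\<in>UNIV. \<Sum>t\<in>UNIV. fls_nth (vec_nth x s * vec_nth y t) k * vec_nth (basis_mult A s t) i)" for i k
    by (simp add: alg_mult_nth extend_scalars_def map_vec_def fls_nth_sum)
  then show "vec_order_ge (m + n) (alg_mult (extend_scalars fls_const A) x y)"
    "vec_coeff (alg_mult (extend_scalars fls_const A) x y) (m + n) =
      alg_mult A (vec_coeff x m) (vec_coeff y n)"
    using xy
    by (simp_all add: vec_order_ge_def fls_order_ge_def vec_coeff_def vec_eq_iff nth alg_mult_nth)
qed

text \<open>The leading coefficient vectors of two zero divisors would be zero divisors in
  \<open>A\<close>.\<close>

lemma no_zero_divisors_laurent:
  assumes "no_zero_divisors A"
  shows "no_zero_divisors (extend_scalars fls_const A)"
  unfolding no_zero_divisors_def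
proof (intro allI impI, rule ccontr)
  fix x y assume "alg_mult (extend_scalars fls_const A) x y = 0" "\<not> (x = 0 \<or> y = 0)"
  moreover from this obtain m n
    where "vec_order_ge m x" "vec_coeff x m \<noteq> 0" "vec_order_ge n y" "vec_coeff y n \<noteq> 0"
    using vec_leading by metis
  ultimately show False
    using vec_mult_order(2)[of m x n y A]
      no_zero_divisorsD[OF assms, of "vec_coeff x m" "vec_coeff y n"]
    by (simp add: vec_coeff_def[of 0] zero_vec_def[symmetric])
qed

text \<open>
  The leading coefficient of \<open>T h\<^sub>1\<^sup>2\<close> is non-zero of odd degree in \<open>T = X\<^sup>-\<^sup>1\<close>, so
  \<open>h\<^sub>0\<^sup>2\<close> must dominate, in degree \<open>0\<close>.
\<close>

lemma laurent_square_root: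
  fixes A :: "('k::field, 'n::finite) inv_alg" and h0 h1 :: "'k fls ^ 'n"
  defines "B \<equiv> extend_scalars fls_const A"
  assumes A: "no_zero_divisors A"
    and eq: "alg_mult B h0 h0 + alg_mult B h1 h0 + (fls_X_inv + fls_const \<delta>) *s alg_mult B h1 h1 =
      map_vec fls_const u"
    and nz: "h0 \<noteq> 0 \<or> h1 \<noteq> 0"
  obtains g where "g \<noteq> 0" "alg_mult A g g = u"
proof -
  note mult = vec_mult_order[where A = A, folded B_def]
  have coeff: "vec_coeff (alg_mult B h0 h0) n + vec_coeff (alg_mult B h1 h0) n +
      (vec_coeff (alg_mult B h1 h1) (n + 1) + \<delta> *s vec_coeff (alg_mult B h1 h1) n) =
      (if n = 0 then u else 0)" for n
    using arg_cong[OF eq, of "\<lambda>x. vec_coeff x n"]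
    by (simp add: vec_coeff_add vec_coeff_map_const vec_coeff_X_inv vec_coeff_const
        vec.scale_left_distrib)
  have sq_nz: "alg_mult A g g \<noteq> 0" if "g \<noteq> 0" for g
    using no_zero_divisorsD[OF A] that by blast
  note witness = that
  have dom0: thesis if n: "vec_order_ge n h0" "vec_coeff h0 n \<noteq> 0" and m: "vec_order_ge (n + 1) h1" for n
  proof -
    have "vec_coeff (alg_mult B h1 h0) (n + n) = 0"
      "vec_coeff (alg_mult B h1 h1) (n + n + 1) = 0" "vec_coeff (alg_mult B h1 h1) (n + n) = 0"
      by (rule vec_coeff_below[OF mult(1)[OF m n(1)]], simp)
        (rule vec_coeff_below[OF mult(1)[OF m m]], simp)+
    then have "alg_mult A (vec_coeff h0 n) (vec_coeff h0 n) = (if n = 0 then u else 0)"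
      using coeff[of "n + n"] mult(2)[OF n(1) n(1)] by simp
    \<comment> \<open>For \<open>n \<noteq> 0\<close> the leading vector of \<open>h0\<close> would
      have square \<open>0\<close>, which \<open>sq_nz\<close> excludes; so \<open>n = 0\<close> and
      that vector is a square root of \<open>u\<close>.\<close>
    then show thesis
      using witness[of "vec_coeff h0 n"] n(2) sq_nz by (auto split: if_splits)
  qed
  have dom1: False if n: "vec_order_ge n h1" "vec_coeff h1 n \<noteq> 0" and m: "vec_order_ge n h0" for n
  proof -
    have "vec_coeff (alg_mult B h1 h0) (n + n - 1) = 0"
      "vec_coeff (alg_mult B h0 h0) (n + n - 1) = 0" "vec_coeff (alg_mult B h1 h1) (n + n - 1) = 0"
      by (rule vec_coeff_below[OF mult(1)[OF n(1) m]], simp)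
        (rule vec_coeff_below[OF mult(1)[OF m m]], simp,
          rule vec_coeff_below[OF mult(1)[OF n(1) n(1)]], simp)
    \<comment> \<open>The index is odd, so the constant right-hand side does not contribute.\<close>
    moreover have "n + n - 1 \<noteq> 0"
      by presburger
    ultimately have "alg_mult A (vec_coeff h1 n) (vec_coeff h1 n) = 0"
      using coeff[of "n + n - 1"] mult(2)[OF n(1) n(1)] by simp
    then show False
      using n(2) sq_nz by blast
  qed
  consider "h1 = 0" "h0 \<noteq> 0" | "h0 = 0" "h1 \<noteq> 0" | "h0 \<noteq> 0" "h1 \<noteq> 0"
    using nz by blast
  then show thesis
  proof cases
    case 1
    then show thesis using vec_leading[of h0] dom0 by auto
  next
    case 2
    then show thesis using vec_leading[of h1] dom1 by (metis vec_order_ge_0)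
  next
    case 3
    obtain n where n: "vec_order_ge n h0" "vec_coeff h0 n \<noteq> 0"
      using vec_leading 3(1) by metis
    obtain m where m: "vec_order_ge m h1" "vec_coeff h1 m \<noteq> 0"
      using vec_leading 3(2) by metis
    show thesis
    proof (cases "n < m")
      case True
      then show thesis
        using dom0[OF n] vec_order_ge_mono[OF m(1)] by simp
    next
      case False
      then show thesis
        using dom1[OF m] vec_order_ge_mono[OF n(1)] by simp
    qed
  qed
qed

section \<open>Norm forms of quaternion algebras\<close>

text \<open>The reduced norm form \<open>[1, \<alpha>] \<bottom> \<beta> [1, \<alpha>]\<close>,
  grouped into the pairs of variables to which \<open>springer_anisotropic\<close> applies.\<close>

definition quat_norm :: "'k::field \<Rightarrow> 'k \<Rightarrow> 'k ^ quat_basis \<Rightarrow> 'k" where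
  "quat_norm \<alpha> \<beta> x = (vec_nth x Q1)\<^sup>2 + vec_nth x Q1 * vec_nth x Qi + \<alpha> * (vec_nth x Qi)\<^sup>2
    + \<beta> * ((vec_nth x Qj)\<^sup>2 + vec_nth x Qj * vec_nth x Qij + \<alpha> * (vec_nth x Qij)\<^sup>2)"

lemma char2_double:
  fixes u v :: "'k::ring_1"
  assumes "CHAR('k) = 2"
  shows "u + u = 0" "u + (u + v) = v"
  using minus_CHAR_2[OF assms, of u u] by (simp_all add: add.assoc[symmetric])

lemma char2_double_vec:
  fixes u v :: "'k::ring_1 ^ 'n"
  assumes "CHAR('k) = 2"
  shows "u + u = 0" "u + (u + v) = v"
  by (simp_all add: vec_eq_iff char2_double[OF assms])

lemma alg_one_quat: "alg_one (quat \<alpha> \<beta>) = axis Q1 1"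
  by (simp add: quat_def)

lemma quat_norm_mult:
  fixes \<alpha> \<beta> :: "'k::field"
  assumes "CHAR('k) = 2"
  shows "alg_mult (quat \<alpha> \<beta>) (alg_inv (quat \<alpha> \<beta>) x) x = quat_norm \<alpha> \<beta> x *s alg_one (quat \<alpha> \<beta>)"
  by (simp add: quat_eq_iff quat_mult_nth[OF assms] quat_inv_nth[OF assms] alg_one_quat axis_def
      quat_norm_def power2_eq_square algebra_simps char2_double[OF assms])


text \<open>Multiplying a product \<open>x y = 0\<close> on the left by the conjugate of
  \<open>x\<close> leaves the norm of \<open>x\<close> times \<open>y\<close>.\<close>

lemma no_zero_divisors_quat:
  fixes \<alpha> \<beta> :: "'k::field"
  assumes "CHAR('k) = 2" and "\<And>x. quat_norm \<alpha> \<beta> x = 0 \<Longrightarrow> x = 0"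
  shows "no_zero_divisors (quat \<alpha> \<beta>)"
  unfolding no_zero_divisors_def
proof (intro allI impI)
  let ?m = "alg_mult (quat \<alpha> \<beta>)"
  fix x y assume "?m x y = 0"
  moreover have "?m (alg_inv (quat \<alpha> \<beta>) x) (?m x y) = quat_norm \<alpha> \<beta> x *s y"
    unfolding quat_presentation(7)[OF assms(1), symmetric] quat_norm_mult[OF assms(1)]
    by (simp add: quat_eq_iff quat_mult_nth[OF assms(1)] alg_one_quat axis_def)
  moreover have "?m z 0 = 0" for z
    by (simp add: alg_mult_def)
  ultimately show "x = 0 \<or> y = 0"
    using assms(2) by auto
qed

lemma UNIV_unit_plus_unit: "(UNIV :: (unit + unit) set) = {Inl (), Inr ()}"
  by (auto simp: UNIV_Plus_UNIV[symmetric] simp del: UNIV_Plus_UNIV)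

lemma sum_unit_plus_unit: "(\<Sum>i\<in>UNIV. f i) = f (Inl ()) + f (Inr ())"
  by (simp add: UNIV_unit_plus_unit)

lemma quat_norm_laurent_anisotropic:
  fixes x :: "'k::field fls ^ quat_basis"
  assumes "diagonal_anisotropic (case_sum (\<lambda>_::unit. 1) (\<lambda>_::unit. \<gamma>))"
    and "quat_norm fls_X_inv (fls_const \<gamma>) x = 0"
  shows "x = 0"
proof -
  have *: "vec_nth x (case_sum (\<lambda>_. Q1) (\<lambda>_. Qj) i) = 0 \<and> vec_nth x (case_sum (\<lambda>_. Qi) (\<lambda>_. Qij) i) = 0"
    for i :: "unit + unit"
    using springer_anisotropic[OF assms(1),
        where x = "\<lambda>i. vec_nth x (case_sum (\<lambda>_. Q1) (\<lambda>_. Qj) i)"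
          and y = "\<lambda>i. vec_nth x (case_sum (\<lambda>_. Qi) (\<lambda>_. Qij) i)" and \<epsilon> = "\<lambda>_. 1" and \<beta> = 0]
      assms(2)
    by (simp add: sum_unit_plus_unit quat_norm_def algebra_simps)
  show ?thesis
    using *[of "Inl ()"] *[of "Inr ()"] by (simp add: quat_eq_iff)
qed

text \<open>In characteristic 2 the \<open>Qi\<close> coordinate of a square is the square of the
  \<open>Qi\<close> coordinate, so it vanishes for a square root of a scalar. What remains is a zero
  of a Springer form in which the constant \<open>1\<close> takes the place of the \<open>Qi\<close>
  coordinate.\<close>

lemma quat_no_square_root_X_inv:
  fixes x :: "'k::field fls ^ quat_basis"
  assumes char: "CHAR('k) = 2"
    and aniso: "diagonal_anisotropic (case_sum (\<lambda>_::unit. 1) (\<lambda>_::unit. \<gamma>))"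
  defines "Q \<equiv> quat fls_X_inv (fls_const \<gamma>)"
  shows "alg_mult Q x x \<noteq> fls_X_inv *s alg_one Q"
proof
  have char': "CHAR('k fls) = 2"
    using char by simp
  assume "alg_mult Q x x = fls_X_inv *s alg_one Q"
  note sq = this[unfolded Q_def quat_eq_iff quat_mult_nth[OF char'] alg_one_quat]
  have "vec_nth x Qi = 0"
    using sq char2_double[OF char'] by (simp add: axis_def algebra_simps)
  with sq have "(vec_nth x Q1)\<^sup>2 + fls_const \<gamma> *
      ((vec_nth x Qj)\<^sup>2 + vec_nth x Qj * vec_nth x Qij + fls_X_inv * (vec_nth x Qij)\<^sup>2) = fls_X_inv"
    by (simp add: axis_def power2_eq_square algebra_simps)
  then have "(vec_nth x Q1)\<^sup>2 + fls_X_inv + fls_const \<gamma> *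
      ((vec_nth x Qj)\<^sup>2 + vec_nth x Qj * vec_nth x Qij + fls_X_inv * (vec_nth x Qij)\<^sup>2) = 0"
    using char2_double[OF char', of fls_X_inv] by (simp add: algebra_simps)
  then show False
    \<comment> \<open>The first pair is \<open>(x, y)\<close> with \<open>y = 1\<close> and has no
      cross term, hence \<open>\<epsilon> = 0\<close> there; the conclusion \<open>y = 0\<close> for
      this pair is the contradiction.\<close>
    using springer_anisotropic[OF aniso,
        where x = "\<lambda>i. vec_nth x (case_sum (\<lambda>_. Q1) (\<lambda>_. Qj) i)"
          and y = "case_sum (\<lambda>_. 1) (\<lambda>_. vec_nth x Qij)" and \<epsilon> = "case_sum (\<lambda>_. 0) (\<lambda>_. 1)"
          and \<beta> = 0 and i = "Inl ()"]
    by (simp add: sum_unit_plus_unit algebra_simps)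
qed

text \<open>The form \<open>N \<bottom> \<delta> N\<close> splits into four pairs of variables, with
  coefficients \<open>1\<close>, \<open>\<gamma>\<close>, \<open>\<delta>\<close> and
  \<open>\<gamma> * \<delta>\<close>.\<close>

lemma quat_norm_pair_laurent_anisotropic:
  fixes p q :: "'k::field fls ^ quat_basis"
  assumes aniso: "diagonal_anisotropic (case_sum (case_sum (\<lambda>_::unit. 1) (\<lambda>_::unit. \<gamma>))
      (case_sum (\<lambda>_::unit. \<delta>) (\<lambda>_::unit. \<gamma> * \<delta>)))"
    and "quat_norm (fls_X_inv + fls_const \<beta>) (fls_const \<gamma>) p +
      fls_const \<delta> * quat_norm (fls_X_inv + fls_const \<beta>) (fls_const \<gamma>) q = 0"
  shows "p = 0 \<and> q = 0"
proof -
  let ?u = "case_sum (\<lambda>_::unit. Q1) (\<lambda>_::unit. Qj)" and ?v = "case_sum (\<lambda>_::unit. Qi) (\<lambda>_::unit. Qij)"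
  let ?x = "case_sum (\<lambda>i. vec_nth p (?u i)) (\<lambda>i. vec_nth q (?u i))"
    and ?y = "case_sum (\<lambda>i. vec_nth p (?v i)) (\<lambda>i. vec_nth q (?v i))"
  have *: "?x i = 0 \<and> ?y i = 0" for i
    using springer_anisotropic[OF aniso, where x = ?x and y = ?y and \<epsilon> = "\<lambda>_. 1" and \<beta> = \<beta>]
      assms(2)
    by (simp add: UNIV_Plus_UNIV[symmetric] sum.Plus UNIV_unit quat_norm_def algebra_simps
        flip: fls_const_mult_const del: UNIV_Plus_UNIV fls_const_mult_const)
  show ?thesis
    using *[of "Inl (Inl ())"] *[of "Inl (Inr ())"] *[of "Inr (Inl ())"] *[of "Inr (Inr ())"]
    by (simp add: quat_eq_iff)
qed

section \<open>Biquaternion algebras\<close>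

lemma alg_mult_add:
  "alg_mult A (x + y) z = alg_mult A x z + alg_mult A y z"
  "alg_mult A x (y + z) = alg_mult A x y + alg_mult A x z"
  by (simp_all add: alg_mult_def distrib_left distrib_right vec.scale_left_distrib sum.distrib)

lemma alg_mult_scale:
  "alg_mult A (r *s x) y = r *s alg_mult A x y"
  "alg_mult A x (r *s y) = r *s alg_mult A x y"
  by (simp_all add: alg_mult_def vec.scale_sum_right vector_smult_assoc ac_simps)

lemma alg_mult_zero [simp]: "alg_mult A 0 y = 0" "alg_mult A x 0 = 0"
  by (simp_all add: alg_mult_def)

lemma linear_alg_mult:
  "Vector_Spaces.linear (*s) (*s) (alg_mult A x)"
  "Vector_Spaces.linear (*s) (*s) (\<lambda>x. alg_mult A x y)"
  by (unfold_locales, simp_all add: alg_mult_add alg_mult_scale)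

lemma alg_inv_add: "alg_inv A (x + y) = alg_inv A x + alg_inv A y"
  by (simp add: alg_inv_def vec.scale_left_distrib sum.distrib)

lemma alg_inv_scale: "alg_inv A (r *s x) = r *s alg_inv A x"
  by (simp add: alg_inv_def vec.scale_sum_right vector_smult_assoc)

lemma alg_inv_zero [simp]: "alg_inv A 0 = 0"
  by (simp add: alg_inv_def)

text \<open>Every vector is the sum of its coordinates times tensors of basis vectors. Identities
  that are additive in each argument thus need checking on pure tensors only.\<close>

lemma pure_tensor_induct [case_names zero add pure]:
  fixes x :: "'k::field ^ ('m::finite \<times> 'n::finite)"
  assumes zero: "P 0" and add: "\<And>x y. P x \<Longrightarrow> P y \<Longrightarrow> P (x + y)"
    and pure: "\<And>u v. P (pure_tensor u v)"
  shows "P x"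
proof -
  have "P (sum f I)" if "\<And>i. P (f i)" for f and I :: "('m \<times> 'n) set"
    by (induction I rule: infinite_finite_induct) (auto intro: assms that)
  moreover have "x = (\<Sum>p\<in>UNIV. pure_tensor (axis (fst p) (vec_nth x p)) (axis (snd p) 1))"
  proof -
    have "(\<Sum>p\<in>UNIV. pure_tensor (axis (fst p) (vec_nth x p)) (axis (snd p) 1)) $ q =
        (\<Sum>p\<in>UNIV. if p = q then vec_nth x p else 0)" for q
      unfolding sum_component by (rule sum.cong) (auto simp: pure_tensor_def axis_def)
    then show ?thesis
      by (simp add: vec_eq_iff)
  qed
  ultimately show ?thesis
    using pure by metis
qed

lemma tensor_alg_assoc:
  assumes "\<And>x y z. alg_mult A (alg_mult A x y) z = alg_mult A x (alg_mult A y z)"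
    and "\<And>x y z. alg_mult B (alg_mult B x y) z = alg_mult B x (alg_mult B y z)"
  shows "alg_mult (tensor_alg A B) (alg_mult (tensor_alg A B) x y) z =
    alg_mult (tensor_alg A B) x (alg_mult (tensor_alg A B) y z)"
proof (induction x rule: pure_tensor_induct)
  case (pure u v)
  show ?case
  proof (induction y rule: pure_tensor_induct)
    case (pure u' v')
    show ?case
      by (induction z rule: pure_tensor_induct)
        (simp_all add: alg_mult_add alg_mult_pure_tensor assms)
  qed (simp_all add: alg_mult_add)
qed (simp_all add: alg_mult_add)

lemma tensor_alg_one:
  assumes "\<And>x. alg_mult A (alg_one A) x = x" "\<And>x. alg_mult A x (alg_one A) = x"
    and "\<And>x. alg_mult B (alg_one B) x = x" "\<And>x. alg_mult B x (alg_one B) = x"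
  shows "alg_mult (tensor_alg A B) (alg_one (tensor_alg A B)) x = x"
    and "alg_mult (tensor_alg A B) x (alg_one (tensor_alg A B)) = x"
proof -
  have one: "alg_one (tensor_alg A B) = pure_tensor (alg_one A) (alg_one B)"
    by (simp add: tensor_alg_def)
  show "alg_mult (tensor_alg A B) (alg_one (tensor_alg A B)) x = x"
    unfolding one by (induction x rule: pure_tensor_induct)
      (simp_all add: alg_mult_add alg_mult_pure_tensor assms)
  show "alg_mult (tensor_alg A B) x (alg_one (tensor_alg A B)) = x"
    unfolding one by (induction x rule: pure_tensor_induct)
      (simp_all add: alg_mult_add alg_mult_pure_tensor assms)
qed

lemma tensor_alg_inv_mult:
  assumes "\<And>x y. alg_inv A (alg_mult A x y) = alg_mult A (alg_inv A y) (alg_inv A x)"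
    and "\<And>x y. alg_inv B (alg_mult B x y) = alg_mult B (alg_inv B y) (alg_inv B x)"
  shows "alg_inv (tensor_alg A B) (alg_mult (tensor_alg A B) x y) =
    alg_mult (tensor_alg A B) (alg_inv (tensor_alg A B) y) (alg_inv (tensor_alg A B) x)"
proof (induction x rule: pure_tensor_induct)
  case (pure u v)
  show ?case
    by (induction y rule: pure_tensor_induct)
      (simp_all add: alg_mult_add alg_inv_add alg_mult_pure_tensor alg_inv_pure_tensor assms)
qed (simp_all add: alg_mult_add alg_inv_add)

section \<open>Generators and relations of \<open>[a + b, c) \<otimes> [a, b)\<close>\<close>

locale biquaternion =
  fixes a b c :: "'k::field"
  assumes char2: "CHAR('k) = 2"
begin

text \<open>The base field stays arbitrary: the same computations serve over the Laurent series and
  over the function field of the conic.\<close>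

definition C :: "('k, quat_basis \<times> quat_basis) inv_alg" where
  "C = tensor_alg (quat (a + b) c) (quat a b)"

abbreviation prod (infixr "\<cdot>" 70) where "prod \<equiv> alg_mult C"
abbreviation one ("\<one>") where "one \<equiv> alg_one C"
abbreviation star where "star \<equiv> alg_inv C"

definition left :: "'k ^ quat_basis \<Rightarrow> 'k ^ (quat_basis \<times> quat_basis)" where
  "left p = pure_tensor p (axis Q1 1)"

definition right :: "'k ^ quat_basis \<Rightarrow> 'k ^ (quat_basis \<times> quat_basis)" where
  "right q = pure_tensor (axis Q1 1) q"


lemma assoc: "(x \<cdot> y) \<cdot> z = x \<cdot> y \<cdot> z"
  unfolding C_def by (intro tensor_alg_assoc quat_presentation(7) char2)

lemma one_mult [simp]: "\<one> \<cdot> x = x" "x \<cdot> \<one> = x"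
  unfolding C_def by (intro tensor_alg_one quat_presentation char2)+

lemma star_mult: "star (x \<cdot> y) = star y \<cdot> star x"
  unfolding C_def by (intro tensor_alg_inv_mult quat_involution(1) char2)

lemma pure_tensor_left_right: "pure_tensor p q = left p \<cdot> right q"
  unfolding left_def right_def C_def alg_mult_pure_tensor
  by (metis alg_one_quat quat_presentation(5,6)[OF char2])

lemma left_right_commute: "right q \<cdot> left p = left p \<cdot> right q"
  unfolding left_def right_def C_def alg_mult_pure_tensor
  by (metis alg_one_quat quat_presentation(5,6)[OF char2])

lemma left_mult: "left p \<cdot> left p' = left (alg_mult (quat (a + b) c) p p')"
  unfolding left_def C_def alg_mult_pure_tensor
  by (metis alg_one_quat quat_presentation(5)[OF char2])

lemma right_mult: "right q \<cdot> right q' = right (alg_mult (quat a b) q q')"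
  unfolding right_def C_def alg_mult_pure_tensor
  by (metis alg_one_quat quat_presentation(5)[OF char2])

lemma left_linear: "left (p + p') = left p + left p'" "left (r *s p) = r *s left p"
  by (simp_all add: left_def pure_tensor_def vec_eq_iff algebra_simps)

lemma right_linear: "right (q + q') = right q + right q'" "right (r *s q) = r *s right q"
  by (simp_all add: right_def pure_tensor_def vec_eq_iff algebra_simps)

lemma left_one: "left (axis Q1 1) = \<one>"
  by (simp add: left_def C_def tensor_alg_def alg_one_quat)

lemma right_one: "right (axis Q1 1) = \<one>"
  by (simp add: right_def C_def tensor_alg_def alg_one_quat)

lemma alg_inv_quat_one: "alg_inv (quat \<alpha> \<beta>) (axis Q1 1) = (axis Q1 1 :: 'k ^ quat_basis)"
  by (simp add: quat_eq_iff quat_inv_nth[OF char2] axis_def)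

lemma star_left: "star (left p) = left (alg_inv (quat (a + b) c) p)"
  by (simp add: left_def C_def alg_inv_pure_tensor alg_inv_quat_one)

lemma star_right: "star (right q) = right (alg_inv (quat a b) q)"
  by (simp add: right_def C_def alg_inv_pure_tensor alg_inv_quat_one)

definition i where "i = left (axis Qi 1)"
definition j where "j = left (axis Qj 1)"
definition k where "k = right (axis Qi 1)"
definition l where "l = right (axis Qj 1)"

lemmas linear_simps =
  alg_mult_add alg_mult_scale alg_inv_add alg_inv_scale vec.scale_right_distrib vec.scale_left_distrib
  vector_smult_assoc char2_double_vec[OF char2] char2_double[OF char2]

lemma star_gen [simp]: "star i = i + \<one>" "star j = j" "star k = k + \<one>" "star l = l"
proof -
  have "alg_inv (quat \<alpha> \<beta>) (axis Qi 1) = axis Qi 1 + (axis Q1 1 :: 'k ^ quat_basis)"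
    "alg_inv (quat \<alpha> \<beta>) (axis Qj 1) = (axis Qj 1 :: 'k ^ quat_basis)" for \<alpha> \<beta>
    by (simp_all add: quat_eq_iff quat_inv_nth[OF char2] axis_def)
  then show "star i = i + \<one>" "star j = j" "star k = k + \<one>" "star l = l"
    by (simp_all add: i_def j_def k_def l_def star_left star_right left_linear right_linear
        left_one right_one)
qed

lemma star_one [simp]: "star \<one> = \<one>"
  by (simp add: star_left alg_inv_quat_one flip: left_one)

lemma gen_mult:
  "i \<cdot> i = i + (a + b) *s \<one>" "j \<cdot> j = c *s \<one>" "j \<cdot> i = i \<cdot> j + j"
  "k \<cdot> k = k + a *s \<one>" "l \<cdot> l = b *s \<one>" "l \<cdot> k = k \<cdot> l + l"
  "k \<cdot> i = i \<cdot> k" "k \<cdot> j = j \<cdot> k" "l \<cdot> i = i \<cdot> l" "l \<cdot> j = j \<cdot> l"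
proof -
  let ?i = "axis Qi 1 :: 'k ^ quat_basis" and ?j = "axis Qj 1 :: 'k ^ quat_basis"
  let ?e = "axis Q1 1 :: 'k ^ quat_basis"
  have "alg_mult (quat \<alpha> \<beta>) ?i ?i = ?i + \<alpha> *s ?e"
    "alg_mult (quat \<alpha> \<beta>) ?j ?j = \<beta> *s ?e"
    "alg_mult (quat \<alpha> \<beta>) ?j ?i = alg_mult (quat \<alpha> \<beta>) ?i ?j + ?j" for \<alpha> \<beta>
    by (simp_all add: quat_eq_iff quat_mult_nth[OF char2] axis_def)
  then show
    "i \<cdot> i = i + (a + b) *s \<one>" "j \<cdot> j = c *s \<one>" "j \<cdot> i = i \<cdot> j + j"
    "k \<cdot> k = k + a *s \<one>" "l \<cdot> l = b *s \<one>" "l \<cdot> k = k \<cdot> l + l"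
    "k \<cdot> i = i \<cdot> k" "k \<cdot> j = j \<cdot> k" "l \<cdot> i = i \<cdot> l" "l \<cdot> j = j \<cdot> l"
    by (simp_all only: i_def j_def k_def l_def left_mult right_mult left_linear right_linear
        left_one right_one left_right_commute)
qed

lemma gen_mult':
  "i \<cdot> i \<cdot> x = i \<cdot> x + (a + b) *s x" "j \<cdot> j \<cdot> x = c *s x" "j \<cdot> i \<cdot> x = i \<cdot> j \<cdot> x + j \<cdot> x"
  "k \<cdot> k \<cdot> x = k \<cdot> x + a *s x" "l \<cdot> l \<cdot> x = b *s x" "l \<cdot> k \<cdot> x = k \<cdot> l \<cdot> x + l \<cdot> x"
  "k \<cdot> i \<cdot> x = i \<cdot> k \<cdot> x" "k \<cdot> j \<cdot> x = j \<cdot> k \<cdot> x" "l \<cdot> i \<cdot> x = i \<cdot> l \<cdot> x" "l \<cdot> j \<cdot> x = j \<cdot> l \<cdot> x"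
  unfolding assoc[symmetric] gen_mult by (simp_all add: alg_mult_add alg_mult_scale assoc)

text \<open>
  Right-associated products are rewritten to combinations of the monomials
  \<open>i\<^sup>p j\<^sup>q k\<^sup>r l\<^sup>s\<close> with exponents at most \<open>1\<close>.
\<close>

lemmas normalize = gen_mult gen_mult' assoc linear_simps

lemma quat_expand:
  "p = vec_nth p Q1 *s axis Q1 1 + vec_nth p Qi *s axis Qi 1 + vec_nth p Qj *s axis Qj 1 +
    vec_nth p Qij *s axis Qij (1 :: 'k)"
  by (simp add: quat_eq_iff axis_def)

lemma left_expand:
  "left p = vec_nth p Q1 *s \<one> + vec_nth p Qi *s i + vec_nth p Qj *s j + vec_nth p Qij *s (i \<cdot> j)"
proof -
  have "i \<cdot> j = left (axis Qij 1)"
    unfolding i_def j_def left_mult quat_presentation(4)[OF char2] ..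
  then show ?thesis
    by (subst quat_expand) (simp only: left_linear left_one i_def[symmetric] j_def[symmetric])
qed

lemma right_expand:
  "right q = vec_nth q Q1 *s \<one> + vec_nth q Qi *s k + vec_nth q Qj *s l + vec_nth q Qij *s (k \<cdot> l)"
proof -
  have "k \<cdot> l = right (axis Qij 1)"
    unfolding k_def l_def right_mult quat_presentation(4)[OF char2] ..
  then show ?thesis
    by (subst quat_expand) (simp only: right_linear right_one k_def[symmetric] l_def[symmetric])
qed

section \<open>The idempotent \<open>e\<close> and the left ideal \<open>C e\<close>\<close>

definition e where "e = i + k + l"

text \<open>The elements \<open>i + k\<close> and \<open>l\<close> satisfy the relations of
  \<open>[b, b)\<close>: with \<open>z = i + k\<close>, one has \<open>z^2 = z + b\<close>,
  \<open>l^2 = b\<close> and \<open>l z = z l + l\<close>. The two copies of \<open>b\<close> and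
  the mixed products cancel to leave \<open>z + l\<close>.\<close>

lemma e_idem: "e \<cdot> e = e"
  by (simp add: e_def normalize ac_simps)

lemma star_e: "star e = e"
  by (simp add: e_def linear_simps ac_simps)

text \<open>Moving \<open>j \<cdot> l\<close> across \<open>i\<close> and across \<open>k\<close>
  shifts each by \<open>\<one>\<close>, and the two shifts cancel in \<open>e\<close>. The last two
  relations make right multiplication by \<open>i\<close> and by \<open>j \<cdot> l\<close> preserve
  \<open>C e\<close>.\<close>

lemma e_rels:
  "e \<cdot> l \<cdot> e = 0" "l \<cdot> e = e \<cdot> l + l" "e \<cdot> i = i \<cdot> e" "e \<cdot> j \<cdot> l = j \<cdot> l \<cdot> e"
  by (simp_all add: e_def normalize ac_simps)

lemma l_left: "l \<cdot> left p = left p \<cdot> l" "l \<cdot> left p \<cdot> x = left p \<cdot> l \<cdot> x"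
  by (simp_all add: l_def left_right_commute flip: assoc)

lemma mult_e_expand: obtains p q where "y \<cdot> e = (left p + l \<cdot> left q) \<cdot> e"
proof -
  have "\<exists>p q. y \<cdot> e = (left p + l \<cdot> left q) \<cdot> e"
  proof (induction y rule: pure_tensor_induct)
    case zero
    have "left 0 = 0"
      by (simp add: left_def pure_tensor_def vec_eq_iff)
    then have "0 \<cdot> e = (left 0 + l \<cdot> left 0) \<cdot> e"
      by simp
    then show ?case by blast
  next
    case (add x y)
    then obtain p q p' q' where
      "x \<cdot> e = (left p + l \<cdot> left q) \<cdot> e" "y \<cdot> e = (left p' + l \<cdot> left q') \<cdot> e"
      by blast
    then have "(x + y) \<cdot> e = (left (p + p') + l \<cdot> left (q + q')) \<cdot> e"
      by (simp add: alg_mult_add left_linear ac_simps)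
    then show ?case by blast
  next
    case (pure u v)
    let ?v = "vec_nth v" and ?m = "alg_mult (quat (a + b) c)"
    \<comment> \<open>Idempotency gives \<open>k \<cdot> e = (\<one> + i + l) \<cdot> e\<close>,
      hence \<open>k \<cdot> l \<cdot> e = (b *s \<one> + l \<cdot> i) \<cdot> e\<close>;
      \<open>p\<close> and \<open>q\<close> collect the terms without and with
      \<open>l\<close>.\<close>
    define p where "p = (?v Q1 + ?v Qi + b * ?v Qij) *s axis Q1 1 + ?v Qi *s axis Qi (1::'k)"
    define q where "q = (?v Qi + ?v Qj) *s axis Q1 1 + ?v Qij *s axis Qi (1::'k)"
    have "right v \<cdot> e = (left p + l \<cdot> left q) \<cdot> e"
      unfolding right_expand left_linear left_one p_def q_def i_def[symmetric]
      by (simp add: e_def normalize ac_simps)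
    then have "left u \<cdot> right v \<cdot> e = (left (?m u p) + l \<cdot> left (?m u q)) \<cdot> e"
      by (simp add: alg_mult_add assoc l_left flip: left_mult)
    then show ?case
      unfolding pure_tensor_left_right assoc by blast
  qed
  then show thesis
    using that by blast
qed

text \<open>The diagonal terms are the two norms, the second with the factor \<open>l^2 = b\<close>.
  The mixed terms add up to a reduced trace times \<open>l\<close>, which
  \<open>e \<cdot> l \<cdot> e = 0\<close> removes.\<close>

lemma star_mult_self:
  assumes "y = (left p + l \<cdot> left q) \<cdot> e"
  shows "star y \<cdot> y = (quat_norm (a + b) c p + b * quat_norm (a + b) c q) *s e"
proof -
  let ?m = "alg_mult (quat (a + b) c)" and ?bar = "alg_inv (quat (a + b) c)"
  have left_left: "left p \<cdot> left q \<cdot> x = left (?m p q) \<cdot> x" for p q x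
    by (simp add: left_mult flip: assoc)
  have bar_norm: "left (?m (?bar p) p) = quat_norm (a + b) c p *s \<one>" for p
    by (simp add: quat_norm_mult[OF char2] left_linear alg_one_quat left_one)
  obtain t where "?m (?bar p) q + ?bar (?m (?bar p) q) = t *s alg_one (quat (a + b) c)"
    using quat_involution(3)[OF char2] by blast
  then have "?m (?bar p) q + ?m (?bar q) p = t *s axis Q1 1"
    by (simp add: quat_involution[OF char2] alg_one_quat)
  then have "?m (?bar q) p = ?m (?bar p) q + t *s axis Q1 1"
    by (metis char2_double_vec(2)[OF char2])
  then have cross: "left (?m (?bar q) p) = left (?m (?bar p) q) + t *s \<one>"
    by (simp add: left_linear left_one)
  have "(left (?bar p) + left (?bar q) \<cdot> l) \<cdot> (left p + l \<cdot> left q) =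
      (quat_norm (a + b) c p + b * quat_norm (a + b) c q) *s \<one> + t *s l"
    by (simp add: alg_mult_add assoc l_left left_left left_mult gen_mult alg_mult_scale)
      (simp add: bar_norm cross linear_simps ac_simps)
  moreover have "star y \<cdot> y = e \<cdot> ((left (?bar p) + left (?bar q) \<cdot> l) \<cdot> (left p + l \<cdot> left q)) \<cdot> e"
    unfolding assms
    by (simp only: star_mult alg_inv_add star_left star_gen star_e assoc)
  ultimately show ?thesis
    by (simp add: alg_mult_add alg_mult_scale e_idem e_rels(1))
qed

lemma e_nonzero:
  assumes "b \<noteq> 0"
  shows "e \<noteq> 0"
proof
  assume "e = 0"
  then have "l = 0"
    using e_rels(2) by (metis add_0 alg_mult_zero)
  then have "l \<cdot> l = 0"
    by simp
  then have "\<one> = 0"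
    using assms by (simp only: gen_mult vector_mul_eq_0) simp
  then have "vec_nth (left (axis Q1 1)) (Q1, Q1) = 0"
    unfolding left_one by simp
  then show False
    by (simp add: left_def pure_tensor_def)
qed

text \<open>Anisotropy of the form forces \<open>z \<cdot> e = 0\<close> for all \<open>z\<close> in
  an isotropic right ideal. Since \<open>l = l \<cdot> e + e \<cdot> l\<close>, applying this to
  \<open>x\<close> and \<open>x \<cdot> l\<close> yields \<open>x \<cdot> l = 0\<close>, and
  \<open>l\<close> is invertible.\<close>

lemma anisotropic_C:
  assumes "\<And>p q. quat_norm (a + b) c p + b * quat_norm (a + b) c q = 0 \<Longrightarrow> p = 0 \<and> q = 0"
    and "b \<noteq> 0"
  shows "anisotropic C"
  unfolding anisotropic_def isotropic_def
proof
  assume "\<exists>I. isotropic_right_ideal C I \<and> I \<noteq> {0}"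
  then obtain I where I: "isotropic_right_ideal C I" "I \<noteq> {0}"
    by blast
  then have "0 \<in> I"
    by (simp add: isotropic_right_ideal_def right_ideal_def vec.subspace_0)
  with I(2) obtain x where x: "x \<in> I" "x \<noteq> 0"
    by blast
  have prod: "z \<cdot> y \<in> I" if "z \<in> I" for z y
    using I(1) that unfolding isotropic_right_ideal_def right_ideal_def by blast
  have zero: "z \<cdot> e = 0" if "z \<in> I" for z
  proof -
    obtain p q where pq: "z \<cdot> e = (left p + l \<cdot> left q) \<cdot> e"
      by (rule mult_e_expand)
    have "star (z \<cdot> e) \<cdot> z \<cdot> e = 0"
      using I(1) prod[OF that] unfolding isotropic_right_ideal_def by blast
    then have "(quat_norm (a + b) c p + b * quat_norm (a + b) c q) *s e = 0"
      using star_mult_self[OF pq] by (simp only:)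
    then have "quat_norm (a + b) c p + b * quat_norm (a + b) c q = 0"
      using e_nonzero[OF assms(2)] by (simp only: vector_mul_eq_0) simp
    then have "p = 0 \<and> q = 0"
      by (rule assms(1))
    moreover have "left 0 = 0"
      by (simp add: left_expand)
    ultimately show ?thesis
      unfolding pq by simp
  qed
  have "x \<cdot> l \<cdot> e = 0"
    using zero[OF prod[OF x(1)]] by (simp add: assoc)
  moreover have "x \<cdot> e \<cdot> l = 0"
    using zero[OF x(1)] by (metis assoc alg_mult_zero(1))
  ultimately have "x \<cdot> l = 0"
    by (simp add: e_rels(2) alg_mult_add)
  then have "x \<cdot> l \<cdot> l = 0"
    by (metis assoc alg_mult_zero(1))
  then show False
    using x \<open>b \<noteq> 0\<close> by (simp add: gen_mult alg_mult_scale)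
qed


text \<open>The algebra is the direct sum of \<open>e C\<close> and \<open>(\<one> + e) C\<close>,
  and left multiplication by \<open>l\<close> maps the second summand bijectively onto the first;
  each has half of the dimension 16.\<close>

lemma dim_range_e:
  assumes "b \<noteq> 0"
  shows "vec.dim (range (\<lambda>x. e \<cdot> x)) = 8"
proof -
  let ?S = "range (\<lambda>x. e \<cdot> x)" and ?T = "range (\<lambda>x. (\<one> + e) \<cdot> x)"
  have sub: "vec.subspace (range (\<lambda>x. z \<cdot> x))" for z
    by (intro vec.linear_subspace_image linear_alg_mult vec.subspace_UNIV)
  have inj: "inj (\<lambda>x. l \<cdot> x)"
  proof (rule injI)
    fix x y assume "l \<cdot> x = l \<cdot> y"
    then have "l \<cdot> l \<cdot> x = l \<cdot> l \<cdot> y"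
      by simp
    then show "x = y"
      using assms by (simp add: gen_mult' vector_mul_lcancel)
  qed
  have l_e: "l \<cdot> (\<one> + e) = e \<cdot> l"
    by (simp add: alg_mult_add e_rels(2) char2_double_vec[OF char2] ac_simps)
  have "(\<lambda>x. l \<cdot> x) ` ?T = ?S"
  proof -
    have "l \<cdot> (\<one> + e) \<cdot> x = e \<cdot> l \<cdot> x" for x
      using l_e by (metis assoc)
    moreover have "e \<cdot> x = e \<cdot> l \<cdot> ((1 / b) *s (l \<cdot> x))" for x
      using assms by (simp add: alg_mult_scale gen_mult' vector_smult_assoc)
    ultimately show ?thesis
      by (auto simp: image_image)
  qed
  then have dim: "vec.dim ?T = vec.dim ?S"
    using vec.dim_image_eq[OF linear_alg_mult(1) inj_on_subset[OF inj subset_UNIV], of ?T] by simp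
  have "{x + y |x y. x \<in> ?S \<and> y \<in> ?T} = UNIV"
  proof -
    have "x = e \<cdot> x + (\<one> + e) \<cdot> x" for x
      by (simp add: alg_mult_add char2_double_vec[OF char2] ac_simps)
    then show ?thesis
      by blast
  qed
  moreover have "?S \<inter> ?T = {0}"
  proof -
    have "x = 0" if "x = e \<cdot> y" "x = (\<one> + e) \<cdot> z" for x y z
    proof -
      have "e \<cdot> x = x"
        using that(1) e_idem by (metis assoc)
      moreover have "e \<cdot> x = 0"
        unfolding that(2) assoc[symmetric]
        by (simp add: alg_mult_add e_idem char2_double_vec[OF char2])
      ultimately show ?thesis by simp
    qed
    then show ?thesis
      using vec.subspace_0[OF sub] by blast
  qed
  moreover have "CARD(quat_basis) = 4"
    by (simp add: UNIV_quat_basis)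
  ultimately show ?thesis
    using vec.dim_sums_Int[OF sub sub, of e "\<one> + e"] dim
    by (simp add: card_cart_basis card_cartesian_product)
qed

text \<open>The point \<open>(x, y)\<close> gives the zero \<open>p = x + y i + j\<close>,
  \<open>q = y\<close> of \<open>N \<bottom> b N\<close>. The right ideal generated by the resulting
  \<open>w\<close> is isotropic, and left multiplication by \<open>w\<close> identifies it with
  \<open>e C\<close>.\<close>

lemma hyperbolic_C:
  assumes conic: "x\<^sup>2 + x * y + a * y\<^sup>2 = c" and nz: "b \<noteq> 0" "b * y\<^sup>2 \<noteq> c"
  shows "hyperbolic C"
proof -
  define p where "p = x *s axis Q1 1 + y *s axis Qi 1 + axis Qj (1 :: 'k)"
  define w where "w = (left p + l \<cdot> left (y *s axis Q1 1)) \<cdot> e"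
  define I where "I = range (\<lambda>z. w \<cdot> z)"
  have w: "w = (x *s \<one> + y *s i + j + y *s l) \<cdot> e"
    by (simp add: w_def p_def left_linear left_one i_def j_def alg_mult_scale)
  have "quat_norm (a + b) c p + b * quat_norm (a + b) c (y *s axis Q1 1) =
      (x\<^sup>2 + x * y + a * y\<^sup>2) + c"
    by (simp add: quat_norm_def p_def axis_def algebra_simps char2_double[OF char2])
  then have "star w \<cdot> w = 0"
    using star_mult_self[OF w_def] conic char2_double[OF char2] by simp
  then have "star (w \<cdot> z) \<cdot> w \<cdot> z' = 0" for z z'
    unfolding star_mult by (metis assoc alg_mult_zero)
  moreover have "vec.subspace I"
    unfolding I_def by (intro vec.linear_subspace_image linear_alg_mult vec.subspace_UNIV)
  ultimately have "isotropic_right_ideal C I"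
    unfolding isotropic_right_ideal_def right_ideal_def I_def by (auto simp: assoc)
  moreover have "vec.dim I = 8"
  proof -
    \<comment> \<open>In \<open>e \<cdot> l \<cdot> w\<close> every term containing
      \<open>e \<cdot> l \<cdot> e\<close> vanishes, leaving \<open>?h \<cdot> e\<close>. As
      \<open>?h\<close> squares to a scalar, \<open>?h \<cdot> e \<cdot> l\<close> takes
      \<open>w\<close> to a multiple of \<open>e\<close>, non-zero by
      \<open>b * y^2 \<noteq> c\<close>.\<close>
    let ?h = "j \<cdot> l + (y * b) *s \<one>"
    have "e \<cdot> l \<cdot> w = ?h \<cdot> e"
      unfolding w e_def by (simp add: normalize ac_simps)
    moreover have "?h \<cdot> ?h = (b * (b * y\<^sup>2 + c)) *s \<one>"
      by (simp add: normalize distrib_left power2_eq_square ac_simps)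
    ultimately have h: "(?h \<cdot> e \<cdot> l) \<cdot> w = (b * (b * y\<^sup>2 + c)) *s e"
      by (metis assoc one_mult(1) alg_mult_scale(1))
    have "b * y\<^sup>2 + c \<noteq> 0"
      using nz(2) minus_CHAR_2[OF char2, of "b * y\<^sup>2" c] by (metis right_minus_eq)
    then have nz': "b * (b * y\<^sup>2 + c) \<noteq> 0"
      using nz(1) by simp
    have inj: "inj_on (\<lambda>z. w \<cdot> z) (range (\<lambda>x. e \<cdot> x))"
    proof (rule inj_onI)
      fix u v assume "u \<in> range (\<lambda>x. e \<cdot> x)" "v \<in> range (\<lambda>x. e \<cdot> x)" and eq: "w \<cdot> u = w \<cdot> v"
      then have uv: "e \<cdot> u = u" "e \<cdot> v = v"
        using e_idem by (auto simp flip: assoc)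
      have "((?h \<cdot> e \<cdot> l) \<cdot> w) \<cdot> u = ((?h \<cdot> e \<cdot> l) \<cdot> w) \<cdot> v"
        using eq by (metis assoc)
      then show "u = v"
        unfolding h alg_mult_scale uv using nz' by (metis vector_mul_lcancel)
    qed
    have span: "vec.span (range (\<lambda>x. e \<cdot> x)) = range (\<lambda>x. e \<cdot> x)"
      unfolding vec.span_eq_iff
      by (intro vec.linear_subspace_image linear_alg_mult vec.subspace_UNIV)
    have "I = (\<lambda>z. w \<cdot> z) ` range (\<lambda>x. e \<cdot> x)"
    proof -
      have "w \<cdot> e \<cdot> z = w \<cdot> z" for z
        unfolding w_def using e_idem by (metis assoc)
      then show ?thesis
        by (simp add: I_def image_image)
    qed
    moreover have "vec.dim ((\<lambda>z. w \<cdot> z) ` range (\<lambda>x. e \<cdot> x)) = vec.dim (range (\<lambda>x. e \<cdot> x))"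
      by (rule vec.dim_image_eq[OF linear_alg_mult(1)]) (simp only: span inj)
    ultimately show ?thesis
      using dim_range_e[OF nz(1)] by simp
  qed
  moreover have "CARD(quat_basis) = 4"
    by (simp add: UNIV_quat_basis)
  ultimately show ?thesis
    unfolding hyperbolic_def
    by (intro exI[of _ I]) (simp add: card_cart_basis card_cartesian_product)
qed

end

section \<open>Actions of biquaternion algebras on small spaces\<close>

lemma vec_reindex_linear:
  fixes x y :: "'k::field ^ 'n::finite" and f :: "'m::finite \<Rightarrow> 'n"
  shows "(\<chi> i. vec_nth x (f i) + vec_nth y (f i)) = (\<chi> i. vec_nth x (f i)) + (\<chi> i. vec_nth y (f i))"
    and "(\<chi> i. r * vec_nth x (f i)) = r *s (\<chi> i. vec_nth x (f i))"
  by (simp_all add: vec_eq_iff)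

lemma quat_norm_nonzero:
  fixes \<alpha> \<beta> :: "'k::field"
  assumes "CHAR('k) = 2" and "no_zero_divisors (quat \<alpha> \<beta>)" and "x \<noteq> 0"
  shows "quat_norm \<alpha> \<beta> x \<noteq> 0"
proof
  assume "quat_norm \<alpha> \<beta> x = 0"
  then have "alg_mult (quat \<alpha> \<beta>) (alg_inv (quat \<alpha> \<beta>) x) x = 0"
    by (simp add: quat_norm_mult[OF assms(1)])
  then have "alg_inv (quat \<alpha> \<beta>) x = 0"
    using no_zero_divisorsD[OF assms(2)] assms(3) by blast
  then show False
    using quat_involution(2)[OF assms(1), of \<alpha> \<beta> x] assms(3) by simp
qed

text \<open>The operators are the generators of \<open>[\<beta>, \<gamma>)\<close> and
  \<open>[\<delta>, \<epsilon>)\<close> in an action of the tensor product on a coordinate space;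
  submodules enter later as stable subspaces.\<close>

locale biquaternion_module =
  fixes \<beta> \<gamma> \<delta> \<epsilon> :: "'k::field" and I J K L :: "'k ^ 'n::finite \<Rightarrow> 'k ^ 'n"
  assumes char2: "CHAR('k) = 2"
    and linear: "Vector_Spaces.linear (*s) (*s) I" "Vector_Spaces.linear (*s) (*s) J"
      "Vector_Spaces.linear (*s) (*s) K" "Vector_Spaces.linear (*s) (*s) L"
    and IJ: "I (I x) = I x + \<beta> *s x" "J (J x) = \<gamma> *s x" "J (I x) = I (J x) + J x"
    and KL: "K (K x) = K x + \<delta> *s x" "L (L x) = \<epsilon> *s x" "L (K x) = K (L x) + L x"
    and commute: "K (I x) = I (K x)" "K (J x) = J (K x)" "L (I x) = I (L x)" "L (J x) = J (L x)"
begin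

abbreviation mult where "mult \<equiv> alg_mult (quat \<beta> \<gamma>)"
abbreviation bar where "bar \<equiv> alg_inv (quat \<beta> \<gamma>)"
abbreviation nrm where "nrm \<equiv> quat_norm \<beta> \<gamma>"

definition act :: "'k ^ quat_basis \<Rightarrow> 'k ^ 'n \<Rightarrow> 'k ^ 'n" where
  "act h x = vec_nth h Q1 *s x + vec_nth h Qi *s I x + vec_nth h Qj *s J x + vec_nth h Qij *s I (J x)"

lemmas op_linear =
  linear[THEN vec.linear_add] linear[THEN vec.linear_scale] linear[THEN vec.linear_0]

lemma act_add: "act (h + h') x = act h x + act h' x" "act h (x + y) = act h x + act h y"
  by (simp_all add: act_def op_linear vec.scale_left_distrib vec.scale_right_distrib ac_simps)

lemma act_scale: "act (r *s h) x = r *s act h x" "act h (r *s x) = r *s act h x"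
  by (simp_all add: act_def op_linear vec.scale_right_distrib ac_simps vector_smult_assoc)

lemma act_zero: "act 0 x = 0" "act h 0 = 0"
  by (simp_all add: act_def op_linear)

lemma act_one: "act (alg_one (quat \<alpha>' \<beta>')) x = x"
  by (simp add: act_def alg_one_quat axis_def)

lemma act_mult: "act (mult h h') x = act h (act h' x)"
  unfolding act_def quat_mult_nth[OF char2]
  by (simp add: op_linear IJ vec.scale_left_distrib vec.scale_right_distrib vector_smult_assoc
      distrib_left distrib_right ac_simps char2_double_vec[OF char2])

lemma act_commute: "K (act h x) = act h (K x)" "L (act h x) = act h (L x)"
  by (simp_all add: act_def op_linear commute)

lemma act_bar_act: "act (bar h) (act h x) = nrm h *s x"
  by (simp add: quat_norm_mult[OF char2] act_scale act_one flip: act_mult)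

text \<open>
  For \<open>v \<in> V\<close> non-zero, the map \<open>(h\<^sub>0, h\<^sub>1) \<mapsto> (h\<^sub>0 + K h\<^sub>1) v\<close> from the 8-dimensional
  \<open>[\<beta>, \<gamma>)\<^sup>2\<close> to \<open>V\<close> is either not injective, or its image contains \<open>L v\<close>. In the first case
  \<open>K v = g v\<close> for some \<open>g\<close>, and the relation expresses \<open>K\<^sup>2 - K = \<delta>\<close>; in the second it
  expresses \<open>L\<^sup>2 = \<epsilon>\<close>.
\<close>

lemma bimodule_relation:
  assumes div: "no_zero_divisors (quat \<beta> \<gamma>)" and \<epsilon>: "\<epsilon> \<noteq> 0"
    and V: "vec.subspace V" "vec.dim V \<le> 8" "V \<noteq> {0}"
    and stable: "\<And>x. x \<in> V \<Longrightarrow> I x \<in> V" "\<And>x. x \<in> V \<Longrightarrow> J x \<in> V"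
      "\<And>x. x \<in> V \<Longrightarrow> K x \<in> V" "\<And>x. x \<in> V \<Longrightarrow> L x \<in> V"
  obtains h0 h1 u where "h0 \<noteq> 0 \<or> h1 \<noteq> 0" "u = 0 \<or> u = \<epsilon>"
    "mult h0 h0 + mult h1 h0 + \<delta> *s mult h1 h1 = u *s alg_one (quat \<beta> \<gamma>)"
proof -
  let ?one = "alg_one (quat \<beta> \<gamma>)"
  obtain v where v: "v \<in> V" "v \<noteq> 0"
    using V(3) vec.subspace_0[OF V(1)] by blast
  have act_inj: "h = 0" if "act h v = 0" for h
  proof (rule ccontr)
    assume "h \<noteq> 0"
    moreover have "nrm h *s v = 0"
      using act_bar_act[of h v] that by (simp add: act_zero)
    ultimately show False
      using v quat_norm_nonzero[OF char2 div] by simp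
  qed
  have act_V: "act h x \<in> V" if "x \<in> V" for h x
    unfolding act_def using that stable V(1) by (intro vec.subspace_add vec.subspace_scale) auto
  define \<Phi> :: "'k ^ (quat_basis + quat_basis) \<Rightarrow> 'k ^ 'n" where
    "\<Phi> z = act (\<chi> i. vec_nth z (Inl i)) v + K (act (\<chi> i. vec_nth z (Inr i)) v)" for z
  have \<Phi>_eq: "\<Phi> (\<chi> s. case_sum (vec_nth h0) (vec_nth h1) s) = act h0 v + K (act h1 v)" for h0 h1
    by (simp add: \<Phi>_def)
  have \<Phi>_linear: "Vector_Spaces.linear (*s) (*s) \<Phi>"
  proof -
    show ?thesis
      by unfold_locales (simp_all add: \<Phi>_def vec_reindex_linear act_add act_scale op_linear
          vec.scale_right_distrib)
  qed
  show thesis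
  proof (cases "inj \<Phi>")
    case False
    then obtain z where z: "z \<noteq> 0" "\<Phi> z = 0"
      using vec.linear_inj_iff_eq_0[OF \<Phi>_linear] by blast
    define h0 h1 :: "'k ^ quat_basis"
      where "h0 = (\<chi> i. vec_nth z (Inl i))" and "h1 = (\<chi> i. vec_nth z (Inr i))"
    have rel: "act h0 v + K (act h1 v) = 0"
      using z(2) by (simp add: \<Phi>_def h0_def h1_def)
    have "h1 \<noteq> 0"
    proof
      assume "h1 = 0"
      moreover from this have "h0 = 0"
        using rel act_inj by (simp add: act_zero op_linear)
      ultimately have "vec_nth z s = 0" for s
        by (cases s) (simp_all add: h0_def h1_def vec_eq_iff)
      then show False
        using z(1) by (simp add: vec_eq_iff)
    qed
    then have n: "nrm h1 \<noteq> 0"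
      by (rule quat_norm_nonzero[OF char2 div])
    \<comment> \<open>This is the quotient of \<open>h0\<close> by \<open>h1\<close> on the left,
      the inverse of \<open>h1\<close> being its conjugate divided by its norm.\<close>
    define g where "g = (1 / nrm h1) *s mult (bar h1) h0"
    have "act (bar h1) (act h0 v) + nrm h1 *s K v = 0"
      using arg_cong[OF rel, of "act (bar h1)"]
      by (simp add: act_add act_zero act_bar_act op_linear flip: act_commute)
    then have "(1 / nrm h1) *s (act (bar h1) (act h0 v) + nrm h1 *s K v) = 0"
      by simp
    then have "act g v + K v = 0"
      using n by (simp add: g_def act_scale act_mult vec.scale_right_distrib vector_smult_assoc)
    then have Kv: "K v = act g v"
      using char2_double_vec(2)[OF char2, of "act g v" "K v"] by simp
    then have "K (act g v) = act g (act g v)"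
      by (simp add: act_commute)
    then have "act g v + \<delta> *s v = act g (act g v)"
      using KL(1)[of v] unfolding Kv by simp
    then have "act (mult g g + mult ?one g + \<delta> *s mult ?one ?one) v = 0"
      by (simp add: act_add act_scale act_mult act_one char2_double_vec[OF char2] add.assoc)
    then have "mult g g + mult ?one g + \<delta> *s mult ?one ?one = 0"
      by (rule act_inj)
    moreover have "?one \<noteq> 0"
      by (simp add: alg_one_quat axis_eq_0_iff)
    ultimately show thesis
      using that[of g ?one 0] by simp
  next
    case True
    have "range \<Phi> \<subseteq> V"
      using act_V stable(3) v(1) V(1) by (auto simp: \<Phi>_def intro: vec.subspace_add)
    moreover have "vec.dim (range \<Phi>) = 8"
    proof -
      have "CARD(quat_basis) = 4"
        by (simp add: UNIV_quat_basis)
      then show ?thesis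
        using vec.dim_image_eq[OF \<Phi>_linear, of UNIV] True
        by (simp add: card_cart_basis card_UNIV_sum)
    qed
    ultimately have "range \<Phi> = V"
      using V(1,2) vec.linear_subspace_image[OF \<Phi>_linear vec.subspace_UNIV]
      by (intro vec.subspace_dim_equal) auto
    then obtain z where "L v = \<Phi> z"
      using stable(4)[OF v(1)] by blast
    then obtain h0 h1 where Lv: "L v = act h0 v + K (act h1 v)"
      by (simp add: \<Phi>_def)
    \<comment> \<open>Substituting \<open>Lv\<close> twice and using
      \<open>K (K x) = K x + \<delta> *s x\<close> brings \<open>L (L v) + \<epsilon> *s v\<close>
      to the form \<open>act q0 v + K (act q1 v)\<close>. It is zero, so injectivity of
      \<open>\<Phi>\<close> gives \<open>q0 = 0\<close>.\<close>
    define q0 q1 where "q0 = mult h0 h0 + mult h1 h0 + \<delta> *s mult h1 h1 + \<epsilon> *s ?one"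
      and "q1 = mult h0 h1 + mult h1 h0"
    have "L (L v) = L (act h0 v + K (act h1 v))"
      by (simp only: Lv)
    also have "\<dots> = act h0 (L v) + K (act h1 (L v)) + act h1 (L v)"
      by (simp add: op_linear act_commute KL(3) act_add ac_simps)
    also have "\<dots> + \<epsilon> *s v = act q0 v + K (act q1 v)"
      by (simp add: Lv q0_def q1_def act_add act_scale act_mult act_one act_commute op_linear KL
          char2_double_vec[OF char2] ac_simps)
    finally have "\<Phi> (\<chi> s. case_sum (vec_nth q0) (vec_nth q1) s) = 0"
      unfolding \<Phi>_eq by (simp add: KL char2_double_vec[OF char2])
    then have "(\<chi> s. case_sum (vec_nth q0) (vec_nth q1) s) = 0"
      using True vec.linear_inj_iff_eq_0[OF \<Phi>_linear] by blast
    then have "vec_nth q0 i = 0" for i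
      by (auto simp: vec_eq_iff dest: spec[of _ "Inl i"])
    then have "q0 = 0"
      by (simp add: vec_eq_iff)
    then have eq: "mult h0 h0 + mult h1 h0 + \<delta> *s mult h1 h1 = \<epsilon> *s ?one"
      unfolding q0_def by (metis add.commute char2_double_vec(2)[OF char2] add.right_neutral)
    moreover have "h0 \<noteq> 0 \<or> h1 \<noteq> 0"
      using eq \<epsilon> by (auto simp: alg_one_quat axis_eq_0_iff)
    ultimately show thesis
      using that by blast
  qed
qed

end

section \<open>From an embedding of \<open>[a, c)\<close> to a module structure on
  \<open>C e\<close>\<close>

context biquaternion
begin

lemma dim_range_mult_e: "vec.dim (range (\<lambda>x. x \<cdot> e)) \<le> 8"
proof -
  define \<Psi> :: "'k ^ (quat_basis + quat_basis) \<Rightarrow> 'k ^ (quat_basis \<times> quat_basis)" where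
    "\<Psi> z = (left (\<chi> i. vec_nth z (Inl i)) + l \<cdot> left (\<chi> i. vec_nth z (Inr i))) \<cdot> e" for z
  have "range (\<lambda>x. x \<cdot> e) \<subseteq> range \<Psi>"
  proof clarify
    fix x
    obtain p q where "x \<cdot> e = (left p + l \<cdot> left q) \<cdot> e"
      by (rule mult_e_expand)
    then have "x \<cdot> e = \<Psi> (\<chi> s. case_sum (vec_nth p) (vec_nth q) s)"
      by (simp add: \<Psi>_def)
    then show "x \<cdot> e \<in> range \<Psi>"
      by blast
  qed
  then have "vec.dim (range (\<lambda>x. x \<cdot> e)) \<le> vec.dim (range \<Psi>)"
    by (rule vec.dim_subset)
  also have "\<dots> \<le> vec.dim (UNIV :: ('k ^ (quat_basis + quat_basis)) set)"
  proof (rule vec.dim_image_le)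
    show "Vector_Spaces.linear (*s) (*s) \<Psi>"
      by unfold_locales
        (simp_all add: \<Psi>_def vec_reindex_linear left_linear alg_mult_add alg_mult_scale vec.scale_right_distrib)
  qed
  also have "\<dots> = 8"
  proof -
    have "CARD(quat_basis) = 4"
      by (simp add: UNIV_quat_basis)
    then show ?thesis
      by (simp add: card_cart_basis card_UNIV_sum)
  qed
  finally show ?thesis .
qed

text \<open>
  If \<open>[a, c)\<close> embeds in \<open>C\<close>, then it acts from the left on \<open>C e\<close>, and the algebra
  \<open>[a + b, b c)\<close> generated by \<open>i\<close> and \<open>j l\<close> acts from the right, since it commutes with \<open>e\<close>.
  The operators below regroup these two actions as one of \<open>[b, c) \<otimes> [a + b, b)\<close>.
\<close>

lemma embedding_relation:
  assumes lin: "Vector_Spaces.linear (*s) (*s) f"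
    and f_one: "f (alg_one (quat a c)) = \<one>"
    and f_mult: "\<And>x y. f (alg_mult (quat a c) x y) = f x \<cdot> f y"
    and nz: "b \<noteq> 0" "c \<noteq> 0" and div: "no_zero_divisors (quat b c)"
  obtains h0 h1 u where "h0 \<noteq> 0 \<or> h1 \<noteq> 0" "u = 0 \<or> u = b"
    "alg_mult (quat b c) h0 h0 + alg_mult (quat b c) h1 h0 + (a + b) *s alg_mult (quat b c) h1 h1 =
      u *s alg_one (quat b c)"
proof -
  define i' j' where "i' = f (axis Qi 1)" and "j' = f (axis Qj 1)"
  let ?i = "axis Qi 1 :: 'k ^ quat_basis" and ?j = "axis Qj 1 :: 'k ^ quat_basis"
  let ?e = "alg_one (quat a c)"
  have "alg_mult (quat a c) ?i ?i = ?i + a *s ?e" "alg_mult (quat a c) ?j ?j = c *s ?e"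
    "alg_mult (quat a c) ?j ?i = alg_mult (quat a c) ?i ?j + ?j"
    by (simp_all add: quat_eq_iff quat_mult_nth[OF char2] alg_one_quat axis_def)
  then have "i' \<cdot> i' = i' + a *s \<one>" "j' \<cdot> j' = c *s \<one>" "j' \<cdot> i' = i' \<cdot> j' + j'"
    unfolding i'_def j'_def f_mult[symmetric]
    by (simp_all add: vec.linear_add[OF lin] vec.linear_scale[OF lin] f_one f_mult)
  then have gen': "i' \<cdot> i' \<cdot> x = i' \<cdot> x + a *s x" "j' \<cdot> j' \<cdot> x = c *s x"
    "j' \<cdot> i' \<cdot> x = i' \<cdot> j' \<cdot> x + j' \<cdot> x" for x
    unfolding assoc[symmetric] by (simp_all add: alg_mult_add alg_mult_scale assoc)
  \<comment> \<open>The sum \<open>I\<close> satisfies \<open>I^2 = I + b\<close>, because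
    \<open>a\<close> and \<open>a + b\<close> add up to \<open>b\<close>. In \<open>L\<close> the
    squares of \<open>j'\<close> and \<open>j \<cdot> l\<close> give \<open>c\<close> and
    \<open>b * c\<close>, normalized to \<open>b\<close> by \<open>1 / c\<close>; both factors shift
    by one, so \<open>L\<close> commutes with \<open>I\<close>.\<close>
  define I where "I = (\<lambda>x. i' \<cdot> x + x \<cdot> i)"
  define J where "J = (\<lambda>x. j' \<cdot> x)"
  define K where "K = (\<lambda>x. x \<cdot> i)"
  define L where "L = (\<lambda>x. (1 / c) *s (j' \<cdot> x \<cdot> j \<cdot> l))"
  note ops = I_def J_def K_def L_def
  interpret ops: biquaternion_module b c "a + b" b I J K L
  proof
    show "CHAR('k) = 2" by (rule char2)
    show "I (x + y) = I x + I y" "I (r *s x) = r *s I x" "J (x + y) = J x + J y" "J (r *s x) = r *s J x"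
      "K (x + y) = K x + K y" "K (r *s x) = r *s K x" "L (x + y) = L x + L y" "L (r *s x) = r *s L x"
      for x y r
      by (simp_all add: ops linear_simps ac_simps)
    show "I (I x) = I x + b *s x" "J (J x) = c *s x" "J (I x) = I (J x) + J x"
      "K (K x) = K x + (a + b) *s x" "L (L x) = b *s x" "L (K x) = K (L x) + L x"
      "K (I x) = I (K x)" "K (J x) = J (K x)" "L (I x) = I (L x)" "L (J x) = J (L x)" for x
      using nz by (simp_all add: ops gen' normalize ac_simps)
  qed
  define V where "V = range (\<lambda>x. x \<cdot> e)"
  have "\<exists>y. I (x \<cdot> e) = y \<cdot> e" "\<exists>y. J (x \<cdot> e) = y \<cdot> e" "\<exists>y. K (x \<cdot> e) = y \<cdot> e" "\<exists>y. L (x \<cdot> e) = y \<cdot> e" for x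
  proof -
    have "I (x \<cdot> e) = (i' \<cdot> x + x \<cdot> i) \<cdot> e" "J (x \<cdot> e) = (j' \<cdot> x) \<cdot> e" "K (x \<cdot> e) = (x \<cdot> i) \<cdot> e"
      "L (x \<cdot> e) = ((1 / c) *s (j' \<cdot> x \<cdot> j \<cdot> l)) \<cdot> e"
      by (simp_all add: ops alg_mult_add alg_mult_scale assoc e_rels(3,4))
    then show "\<exists>y. I (x \<cdot> e) = y \<cdot> e" "\<exists>y. J (x \<cdot> e) = y \<cdot> e" "\<exists>y. K (x \<cdot> e) = y \<cdot> e" "\<exists>y. L (x \<cdot> e) = y \<cdot> e"
      by blast+
  qed
  then have stable: "x \<in> V \<Longrightarrow> I x \<in> V" "x \<in> V \<Longrightarrow> J x \<in> V" "x \<in> V \<Longrightarrow> K x \<in> V" "x \<in> V \<Longrightarrow> L x \<in> V" for x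
    unfolding V_def by (blast, blast, blast, blast)
  have "e \<in> V"
    unfolding V_def by (metis rangeI e_idem)
  then have "V \<noteq> {0}"
    using e_nonzero[OF nz(1)] by blast
  moreover have "vec.subspace V"
    unfolding V_def by (intro vec.linear_subspace_image linear_alg_mult vec.subspace_UNIV)
  moreover have "vec.dim V \<le> 8"
    unfolding V_def by (rule dim_range_mult_e)
  ultimately show thesis
    using ops.bimodule_relation[OF div nz(1) _ _ _ stable] that by blast
qed

end

section \<open>Scalar extension and the function field of the conic\<close>

lemma extend_scalars_quat:
  fixes \<phi> :: "'k::field \<Rightarrow> 'l::field"
  assumes "\<phi> 0 = 0" "\<phi> 1 = 1" "\<And>u v. \<phi> (u + v) = \<phi> u + \<phi> v" "\<And>u v. \<phi> (u * v) = \<phi> u * \<phi> v"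
  shows "extend_scalars \<phi> (quat \<alpha> \<beta>) = quat (\<phi> \<alpha>) (\<phi> \<beta>)"
proof -
  have neg: "\<phi> (- u) = - \<phi> u" for u
    using assms(3)[of u "- u"] assms(1) by (simp add: eq_neg_iff_add_eq_0 add.commute)
  have axis: "map_vec \<phi> (axis s u) = axis s (\<phi> u)" for s :: quat_basis and u
    by (simp add: map_vec_def axis_def vec_eq_iff assms(1))
  have hom: "map_vec \<phi> (x + y) = map_vec \<phi> x + map_vec \<phi> y" "map_vec \<phi> (- x) = - map_vec \<phi> x"
    "map_vec \<phi> (x - y) = map_vec \<phi> x - map_vec \<phi> y" for x y :: "'k ^ quat_basis"
    using assms(3)[of _ "- _"] neg by (simp_all add: map_vec_def vec_eq_iff assms(3))
  have "map_vec \<phi> (quat_basis_mult \<alpha> \<beta> s t) = quat_basis_mult (\<phi> \<alpha>) (\<phi> \<beta>) s t"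
    "map_vec \<phi> (quat_basis_inv s) = quat_basis_inv s" for s t
    by (cases s; cases t; simp add: hom axis assms)+
  then show ?thesis
    by (simp add: extend_scalars_def quat_def axis assms(2))
qed

lemma extend_scalars_tensor_alg:
  fixes A :: "('k::field, 'm::finite) inv_alg" and B :: "('k, 'n::finite) inv_alg"
    and \<phi> :: "'k \<Rightarrow> 'l::field"
  assumes "\<And>u v. \<phi> (u * v) = \<phi> u * \<phi> v"
  shows "extend_scalars \<phi> (tensor_alg A B) = tensor_alg (extend_scalars \<phi> A) (extend_scalars \<phi> B)"
proof -
  have "map_vec \<phi> (pure_tensor x y) = pure_tensor (map_vec \<phi> x) (map_vec \<phi> y)"
    for x :: "'k ^ 'm" and y :: "'k ^ 'n"
    by (simp add: map_vec_def pure_tensor_def assms)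
  then show ?thesis
    by (simp add: extend_scalars_def tensor_alg_def)
qed

lemma conic_embed_0: "conic_embed 0 = (0 :: 'f::field conic_field)"
proof -
  have "(conic_embed 0 :: 'f conic_field) = conic_embed 0 + conic_embed 0"
    using conic_embed_hom(2)[of 0 "0 :: 'f laurent3"] by (simp only: add_0_right)
  then show ?thesis
    by (simp only: add_cancel_right_right)
qed

lemma CHAR_conic_field:
  assumes "CHAR('f::field) = 2"
  shows "CHAR('f::field conic_field) = 2"
proof (rule CHAR_eq_posI)
  have "(1 :: 'f laurent3) + 1 = 0"
    by (rule char2_double) (simp add: assms)
  then have "(1 :: 'f conic_field) + 1 = 0"
    by (metis conic_embed_0 conic_embed_hom(1,2))
  then show "of_nat 2 = (0 :: 'f conic_field)"
    by simp
next
  fix x :: nat assume "0 < x" "x < 2"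
  then show "of_nat x \<noteq> (0 :: 'f conic_field)"
    by (metis One_nat_def Suc_1 less_Suc_eq less_one not_less_zero of_nat_1 zero_neq_one)
qed simp

text \<open>The generic point: the classes of the two coordinate functions of the affine
  chart.\<close>

lemma conic_point:
  assumes "CHAR('f::field) = 2"
  obtains x y :: "'f::field conic_field" where
    "x\<^sup>2 + x * y + conic_embed gen_a * y\<^sup>2 = conic_embed gen_c"
    "conic_embed gen_b * y\<^sup>2 \<noteq> conic_embed gen_c"
proof
  define \<iota> where "\<iota> p = Fract (abs_conic_ring p) 1" for p :: "'f laurent3 poly poly"
  have \<iota>: "\<iota> (p + q) = \<iota> p + \<iota> q" "\<iota> (p * q) = \<iota> p * \<iota> q" for p q
    by (simp_all add: \<iota>_def plus_conic_ring.abs_eq times_conic_ring.abs_eq)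
  have \<iota>_0: "\<iota> p = 0 \<longleftrightarrow> conic_poly gen_a gen_c dvd p" for p
  proof -
    have "\<iota> p = 0 \<longleftrightarrow> abs_conic_ring p = 0"
      unfolding \<iota>_def Zero_fract_def by (subst eq_fract) (simp_all only: mult_1_right one_neq_zero not_False_eq_True)
    also have "\<dots> \<longleftrightarrow> conic_poly gen_a gen_c dvd p"
      unfolding zero_conic_ring_def conic_ring.abs_eq_iff conic_rel_def by (simp only: diff_0_right)
    finally show ?thesis .
  qed
  have emb: "conic_embed u = \<iota> [:[:u:]:]" for u
    by (simp add: conic_embed_def \<iota>_def)
  let ?x = "\<iota> [:0, 1:]" and ?y = "\<iota> [:[:0, 1:]:]"
  have dbl: "u + v = 0 \<longleftrightarrow> u = v" for u v :: "'f conic_field"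
    using minus_CHAR_2[OF CHAR_conic_field[OF assms], of u v] by (metis right_minus_eq)
  have "?x\<^sup>2 + ?x * ?y + conic_embed gen_a * ?y\<^sup>2 + conic_embed gen_c = \<iota> (conic_poly gen_a gen_c)"
    unfolding emb power2_eq_square \<iota>[symmetric] by (simp add: conic_poly_def)
  then have "?x\<^sup>2 + ?x * ?y + conic_embed gen_a * ?y\<^sup>2 + conic_embed gen_c = 0"
    using \<iota>_0 by simp
  then show "?x\<^sup>2 + ?x * ?y + conic_embed gen_a * ?y\<^sup>2 = conic_embed gen_c"
    by (simp only: dbl)
  have "conic_embed gen_b * ?y\<^sup>2 + conic_embed gen_c = \<iota> [:[:gen_c, 0, gen_b:], 0:]"
    unfolding emb power2_eq_square \<iota>[symmetric] by simp
  \<comment> \<open>The polynomial \<open>b y^2 + c\<close> does not involve the outer variable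
    \<open>x\<close>, so the conic polynomial, monic of degree 2 in \<open>x\<close>, can divide it
    only if it is zero.\<close>
  moreover have "\<not> conic_poly gen_a gen_c dvd [:[:gen_c, 0, gen_b :: 'f laurent3:], 0:]"
    using conic_poly_dvd_linear(1) by (fastforce simp: gen_b_def)
  ultimately have "conic_embed gen_b * ?y\<^sup>2 + conic_embed gen_c \<noteq> 0"
    using \<iota>_0 by simp
  then show "conic_embed gen_b * ?y\<^sup>2 \<noteq> conic_embed gen_c"
    by (simp only: dbl not_False_eq_True)
qed

lemma conic_embed_eq_0_iff: "conic_embed u = (0 :: 'f::field conic_field) \<longleftrightarrow> u = 0"
proof
  assume "conic_embed u = (0 :: 'f conic_field)"
  then have "conic_embed (u * inverse u) = (0 :: 'f conic_field)"
    by (simp add: conic_embed_hom)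
  then show "u = 0"
    using conic_embed_hom(1) by (metis right_inverse zero_neq_one)
qed (simp add: conic_embed_0)

lemma diagonal_anisotropic_one_c:
  "diagonal_anisotropic (case_sum (\<lambda>_::unit. 1) (\<lambda>_::unit. fls_X_inv :: 'k::field fls))"
  using diagonal_anisotropic_laurent[OF diagonal_anisotropic_one] by simp

text \<open>The diagonal form with coefficients \<open>1, c, b, b c\<close> over
  \<open>F\<^sub>0((c\<^sup>-\<^sup>1))((b\<^sup>-\<^sup>1))\<close>, obtained by adjoining
  \<open>b\<close> to the form with coefficients \<open>1, c\<close>.\<close>

lemma diagonal_anisotropic_one_c_b:
  "diagonal_anisotropic (case_sum (case_sum (\<lambda>_::unit. 1) (\<lambda>_::unit. fls_const fls_X_inv))
    (case_sum (\<lambda>_::unit. fls_X_inv) (\<lambda>_::unit. fls_const fls_X_inv * fls_X_inv :: 'k::field fls fls)))"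
proof -
  have "case_sum (case_sum (\<lambda>_::unit. 1) (\<lambda>_::unit. fls_const fls_X_inv))
      (case_sum (\<lambda>_::unit. fls_X_inv) (\<lambda>_::unit. fls_const fls_X_inv * fls_X_inv :: 'k fls fls)) =
    case_sum (\<lambda>i. fls_const (case_sum (\<lambda>_. 1) (\<lambda>_. fls_X_inv) i))
      (\<lambda>i. fls_const (case_sum (\<lambda>_. 1) (\<lambda>_. fls_X_inv) i) * fls_X_inv)"
    by (auto simp: fun_eq_iff split: sum.split)
  then show ?thesis
    using diagonal_anisotropic_laurent[OF diagonal_anisotropic_one_c] by simp
qed

theorem corollary4p4:
  fixes C :: "('f::field laurent3, quat_basis \<times> quat_basis) inv_alg"
    and Q :: "('f laurent3, quat_basis) inv_alg"
  assumes "CHAR('f) = 2"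
    and "Q = quat gen_a gen_c"
    and "C = tensor_alg (quat (gen_a + gen_b) gen_c) (quat gen_a gen_b)"
  shows "anisotropic C \<and>
    hyperbolic (extend_scalars (conic_embed :: 'f laurent3 \<Rightarrow> 'f conic_field) C) \<and>
    \<not> (\<exists>S. stable_subalgebra C S \<and> isomorphic_to_subalgebra Q C S)"
proof (intro conjI)
  have char: "CHAR('f laurent3) = 2" "CHAR('f fls fls) = 2" "CHAR('f conic_field) = 2"
    "CHAR('f fls) = 2"
    using assms(1) CHAR_conic_field[OF assms(1)] by simp_all
  interpret F: biquaternion "gen_a :: 'f laurent3" gen_b gen_c
    by unfold_locales (rule char)
  have C: "C = F.C"
    unfolding assms(3) F.C_def ..
  have nz: "(gen_b :: 'f laurent3) \<noteq> 0" "(gen_c :: 'f laurent3) \<noteq> 0"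
    by (simp_all add: gen_b_def gen_c_def)
  \<comment> \<open>Here \<open>a\<close> is the inverse of the outermost variable, and
    \<open>\<beta>\<close>, \<open>\<gamma>\<close>, \<open>\<delta>\<close> are \<open>b\<close>,
    \<open>c\<close>, \<open>b\<close> in the coefficient field.\<close>
  have "p = 0 \<and> q = 0" if "quat_norm (gen_a + gen_b) gen_c p +
      gen_b * quat_norm (gen_a + gen_b) gen_c q = 0" for p q :: "'f laurent3 ^ quat_basis"
    using quat_norm_pair_laurent_anisotropic[OF diagonal_anisotropic_one_c_b] that
    unfolding gen_a_def gen_b_def gen_c_def by blast
  then show "anisotropic C"
    unfolding C using nz(1) by (rule F.anisotropic_C)

  let ?\<phi> = "conic_embed :: 'f laurent3 \<Rightarrow> 'f conic_field"
  interpret L: biquaternion "?\<phi> gen_a" "?\<phi> gen_b" "?\<phi> gen_c"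
    by unfold_locales (rule char)
  have "extend_scalars ?\<phi> C = L.C"
    unfolding assms(3) L.C_def
    by (simp add: extend_scalars_tensor_alg extend_scalars_quat conic_embed_hom conic_embed_0)
  moreover obtain x y where "x\<^sup>2 + x * y + ?\<phi> gen_a * y\<^sup>2 = ?\<phi> gen_c" "?\<phi> gen_b * y\<^sup>2 \<noteq> ?\<phi> gen_c"
    using conic_point[OF assms(1)] by blast
  moreover have "?\<phi> gen_b \<noteq> 0"
    using nz(1) by (simp only: conic_embed_eq_0_iff not_False_eq_True)
  ultimately show "hyperbolic (extend_scalars ?\<phi> C)"
    using L.hyperbolic_C by simp

  \<comment> \<open>This is \<open>[b, c)\<close> over the coefficient field, before the variable of
    \<open>a\<close> is adjoined.\<close>
  let ?A = "quat fls_X_inv (fls_const fls_X_inv) :: ('f fls fls, quat_basis) inv_alg"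
  have A: "no_zero_divisors ?A"
    by (rule no_zero_divisors_quat[OF char(2)])
      (rule quat_norm_laurent_anisotropic[OF diagonal_anisotropic_one_c])
  have ext: "extend_scalars fls_const ?A = quat gen_b gen_c"
    unfolding gen_b_def gen_c_def by (rule extend_scalars_quat) (simp_all add: fls_plus_const)
  have div: "no_zero_divisors (quat gen_b gen_c :: ('f laurent3, quat_basis) inv_alg)"
    unfolding ext[symmetric] by (rule no_zero_divisors_laurent[OF A])
  show "\<not> (\<exists>S. stable_subalgebra C S \<and> isomorphic_to_subalgebra Q C S)"
  proof
    assume "\<exists>S. stable_subalgebra C S \<and> isomorphic_to_subalgebra Q C S"
    then obtain S where "isomorphic_to_subalgebra (quat gen_a gen_c) F.C S"
      unfolding assms(2) C by (elim exE conjE)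
    then obtain f where f: "Vector_Spaces.linear (*s) (*s) f" "f (alg_one (quat gen_a gen_c)) = alg_one F.C"
      "\<forall>x y. f (alg_mult (quat gen_a gen_c) x y) = alg_mult F.C (f x) (f y)"
      unfolding isomorphic_to_subalgebra_def by (elim exE conjE)
    obtain h0 h1 :: "'f laurent3 ^ quat_basis" and u where h: "h0 \<noteq> 0 \<or> h1 \<noteq> 0" "u = 0 \<or> u = gen_b"
      and eq: "alg_mult (quat gen_b gen_c) h0 h0 + alg_mult (quat gen_b gen_c) h1 h0 +
        (gen_a + gen_b) *s alg_mult (quat gen_b gen_c) h1 h1 = u *s alg_one (quat gen_b gen_c)"
      by (rule F.embedding_relation[OF f(1,2) f(3)[rule_format] nz div])
    \<comment> \<open>Both values \<open>0\<close> and \<open>b\<close> of \<open>u\<close> are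
      constant in the variable of \<open>a\<close>; \<open>w\<close> is the corresponding element of
      the coefficient field.\<close>
    define w :: "'f fls fls" where "w = (if u = 0 then 0 else fls_X_inv)"
    have "u *s alg_one (quat gen_b gen_c) = map_vec fls_const (w *s alg_one ?A)"
      using h(2) by (auto simp: w_def alg_one_quat map_vec_def vec_eq_iff axis_def gen_b_def)
    with eq have "alg_mult (extend_scalars fls_const ?A) h0 h0 +
        alg_mult (extend_scalars fls_const ?A) h1 h0 +
        (fls_X_inv + fls_const fls_X_inv) *s alg_mult (extend_scalars fls_const ?A) h1 h1 =
        map_vec fls_const (w *s alg_one ?A)"
      unfolding ext by (simp add: gen_a_def gen_b_def)
    then obtain g where g: "g \<noteq> 0" "alg_mult ?A g g = w *s alg_one ?A"
      using laurent_square_root[OF A _ h(1)] by blast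
    show False
    proof (cases "u = 0")
      case True
      then show False
        using g no_zero_divisorsD[OF A, of g g] by (simp add: w_def)
    next
      case False
      then show False
        using g(2) quat_no_square_root_X_inv[OF char(4) diagonal_anisotropic_one_c]
        by (simp add: w_def)
    qed
  qed
qed

end
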